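(* Let $\mathcal{C}$ be a generalized Reedy category and let $k$ be a commutative ring. Then for every pair of objects $x,y\in\mathrm{Ob}(\mathcal{C})$ there is a natural isomorphism of $k$-modules $$\mathrm{Hom}_{k\mathcal{C}}(\Delta_y,\Delta_x)\;\cong\;\ker\bigl(M_{x,y}^{\mathsf T}\bigr),$$ where $M_{x,y}^{\mathsf T}$ is regarded as the $k$-linear map $(k\mathcal{C}^+(x,y))^*\to(k\mathcal{F}_{x,y})^*$, $(M_{x,y}^{\mathsf T}\rho)(F)=\sum_{f\in F}\rho(f)$.
   Context: Composition is written right to left. A generalized Reedy category is a small skeletal category $\mathcal{C}$ with a degree map $d:\mathrm{Ob}(\mathcal{C})\to\mathbb{N}$ and wide subcategories $\mathcal{C}^+,\mathcal{C}^-$ such that: (1) $\mathcal{C}^+(x,y)\neq\varnothing$ only if $x=y$ or $d(x)<d(y)$; (2) $\mathcal{C}^-(x,y)\neq\varnothing$ only if $x=y$ or $d(x)>d(y)$; (3) $\mathcal{C}^+(x,x)=\mathcal{C}^-(x,x)=G_x$, the automorphism group of $x$; (4) every morphism $f$ factors as $f=f^+\circ f^-$ with $f^\pm$ in $\mathcal{C}^\pm$, uniquely up to automorphisms (two such factorizations pass through the same object and differ by an automorphism of it). Throughout it is assumed that for each $n$ there are finitely many objects of degree $n$, and that all sets $\mathcal{C}(x,y)$ are finite. A $\mathcal{C}$-module is a covariant functor from $\mathcal{C}$ to $k$-modules; $\mathrm{Hom}_{k\mathcal{C}}$ denotes natural transformations. $P_x=k\mathcal{C}(x,-)$; $\mathfrak{I}_x\subseteq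 P_x$ is the submodule generated by the morphisms $x\to z$ in $\mathcal{C}^-$ with $d(z)<d(x)$; the standard module is $\Delta_x=P_x/\mathfrak{I}_x$. A morphism $h$ of $\mathcal{C}^-$ is unfactorizable if it is not an isomorphism and whenever $h=g\circ g'$ in $\mathcal{C}^-$ one of $g,g'$ is an isomorphism. For each $y,z$ choose one representative from each orbit of the left $G_z$-action on the set of unfactorizable morphisms in $\mathcal{C}^-(y,z)$; let $\mathbb{U}_y$ be the (finite) set of all chosen representatives with source $y$. For $h:y\to z$ in $\mathbb{U}_y$ and $\alpha\in\mathcal{C}^+(x,z)$ let $F_{h,\alpha}=\{\beta\in\mathcal{C}^+(x,y)\mid h\circ\beta=\alpha\}$. The set $\mathcal{F}_{x,y}$ of fibers consists of all nonempty sets $F_{h,\alpha}$ (it does not depend on the choice of representatives). $M_{x,y}$ is the matrix with rows indexed by $\mathcal{C}^+(x,y)$ and columns indexed by $\mathcal{F}_{x,y}$, with entry $1$ at $(f,F)$ if $f\in F$ and $0$ otherwise. For a set $S$, $kS$ is the free $k$-module on $S$ and $(kS)^*=\mathrm{Hom}_k(kS,k)$, identified with functions $S\to k$. *)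

theory Defs
  imports "HOL-Algebra.AbelCoset" "HOL-Algebra.Module" "HOL-Library.FuncSet"
begin

section \<open>Categories\<close>

record ('o, 'm) category =
  Obj :: "'o set"
  Arr :: "'m set"
  src :: "'m \<Rightarrow> 'o"
  tgt :: "'m \<Rightarrow> 'o"
  idt :: "'o \<Rightarrow> 'm"
  cmp :: "'m \<Rightarrow> 'm \<Rightarrow> 'm" (infixr \<open>\<cdot>\<index>\<close> 70)

definition homset :: "('o, 'm, 'z) category_scheme \<Rightarrow> 'o \<Rightarrow> 'o \<Rightarrow> 'm set" where
  "homset C x y = {f \<in> Arr C. src C f = x \<and> tgt C f = y}"

text \<open>Composition is written right to left.\<close>

locale category =
  fixes C :: "('o, 'm, 'z) category_scheme" (structure)
  assumes src_Obj: "f \<in> Arr C \<Longrightarrow> src C f \<in> Obj C"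
    and tgt_Obj: "f \<in> Arr C \<Longrightarrow> tgt C f \<in> Obj C"
    and idt_homset: "x \<in> Obj C \<Longrightarrow> idt C x \<in> homset C x x"
    and cmp_homset: "f \<in> homset C x y \<Longrightarrow> g \<in> homset C y z \<Longrightarrow> g \<cdot> f \<in> homset C x z"
    and cmp_idt_right: "f \<in> homset C x y \<Longrightarrow> f \<cdot> idt C x = f"
    and cmp_idt_left: "f \<in> homset C x y \<Longrightarrow> idt C y \<cdot> f = f"
    and cmp_assoc: "f \<in> homset C x y \<Longrightarrow> g \<in> homset C y z \<Longrightarrow> h \<in> homset C z w
                      \<Longrightarrow> (h \<cdot> g) \<cdot> f = h \<cdot> (g \<cdot> f)"

definition inverse_arrows :: "('o, 'm, 'z) category_scheme \<Rightarrow> 'm \<Rightarrow> 'm \<Rightarrow> bool" where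
  "inverse_arrows C f g \<longleftrightarrow> f \<in> Arr C \<and> g \<in> homset C (tgt C f) (src C f) \<and>
     g \<cdot>\<^bsub>C\<^esub> f = idt C (src C f) \<and> f \<cdot>\<^bsub>C\<^esub> g = idt C (tgt C f)"

definition iso_arrow :: "('o, 'm, 'z) category_scheme \<Rightarrow> 'm \<Rightarrow> bool" where
  "iso_arrow C f \<longleftrightarrow> (\<exists>g. inverse_arrows C f g)"

definition Aut :: "('o, 'm, 'z) category_scheme \<Rightarrow> 'o \<Rightarrow> 'm set" where
  "Aut C x = {f \<in> homset C x x. iso_arrow C f}"

definition skeletal :: "('o, 'm, 'z) category_scheme \<Rightarrow> bool" where
  "skeletal C \<longleftrightarrow> (\<forall>x\<in>Obj C. \<forall>y\<in>Obj C. (\<exists>f\<in>homset C x y. iso_arrow C f) \<longrightarrow> x = y)"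

definition wide_subcategory :: "('o, 'm, 'z) category_scheme \<Rightarrow> 'm set \<Rightarrow> bool" where
  "wide_subcategory C D \<longleftrightarrow> D \<subseteq> Arr C \<and> (\<forall>x\<in>Obj C. idt C x \<in> D) \<and>
     (\<forall>f\<in>D. \<forall>g\<in>D. src C g = tgt C f \<longrightarrow> g \<cdot>\<^bsub>C\<^esub> f \<in> D)"


section \<open>Generalized Reedy categories\<close>

record ('o, 'm) reedy = "('o, 'm) category" +
  deg :: "'o \<Rightarrow> nat"
  Plus :: "'m set"
  Minus :: "'m set"

definition plus_hom :: "('o, 'm, 'z) reedy_scheme \<Rightarrow> 'o \<Rightarrow> 'o \<Rightarrow> 'm set" where
  "plus_hom C x y = homset C x y \<inter> Plus C"

definition minus_hom :: "('o, 'm, 'z) reedy_scheme \<Rightarrow> 'o \<Rightarrow> 'o \<Rightarrow> 'm set" where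
  "minus_hom C x y = homset C x y \<inter> Minus C"

text \<open>The last two assumptions are the standing finiteness hypotheses.\<close>

locale generalized_reedy = category C
  for C :: "('o, 'm, 'z) reedy_scheme" (structure) +
  assumes skeletal: "skeletal C"
    and wide_Plus: "wide_subcategory C (Plus C)"
    and wide_Minus: "wide_subcategory C (Minus C)"
    and plus_deg: "x \<in> Obj C \<Longrightarrow> y \<in> Obj C \<Longrightarrow> plus_hom C x y \<noteq> {} \<Longrightarrow> x = y \<or> deg C x < deg C y"
    and minus_deg: "x \<in> Obj C \<Longrightarrow> y \<in> Obj C \<Longrightarrow> minus_hom C x y \<noteq> {} \<Longrightarrow> x = y \<or> deg C x > deg C y"
    and plus_Aut: "x \<in> Obj C \<Longrightarrow> plus_hom C x x = Aut C x"
    and minus_Aut: "x \<in> Obj C \<Longrightarrow> minus_hom C x x = Aut C x"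
    and factorization: "f \<in> homset C x y \<Longrightarrow>
      \<exists>w\<in>Obj C. \<exists>p\<in>minus_hom C x w. \<exists>q\<in>plus_hom C w y. f = q \<cdot> p"
    and factorization_unique:
      "p \<in> minus_hom C x w \<Longrightarrow> q \<in> plus_hom C w y \<Longrightarrow>
       p' \<in> minus_hom C x w' \<Longrightarrow> q' \<in> plus_hom C w' y \<Longrightarrow> q \<cdot> p = q' \<cdot> p' \<Longrightarrow>
       w = w' \<and> (\<exists>a\<in>Aut C w. \<exists>b. inverse_arrows C a b \<and> p' = a \<cdot> p \<and> q' = q \<cdot> b)"
    and finite_degree: "finite {x \<in> Obj C. deg C x = n}"
    and finite_homset: "x \<in> Obj C \<Longrightarrow> y \<in> Obj C \<Longrightarrow> finite (homset C x y)"


section \<open>Linear algebra over a commutative ring\<close>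

text \<open>The fields \<open>mult\<close> and \<open>one\<close> that a module record inherits from the ring record
  carry no information.\<close>

definition module_hom ::
  "('k, 'r) ring_scheme \<Rightarrow> ('k, 'v, 'a) module_scheme \<Rightarrow> ('k, 'w, 'b) module_scheme \<Rightarrow> ('v \<Rightarrow> 'w) set"
  where "module_hom k M N = {h \<in> hom (add_monoid M) (add_monoid N).
     \<forall>r\<in>carrier k. \<forall>v\<in>carrier M. h (r \<odot>\<^bsub>M\<^esub> v) = r \<odot>\<^bsub>N\<^esub> h v}"

definition module_iso ::
  "('k, 'r) ring_scheme \<Rightarrow> ('k, 'v, 'a) module_scheme \<Rightarrow> ('k, 'w, 'b) module_scheme \<Rightarrow> ('v \<Rightarrow> 'w) set"
  where "module_iso k M N = {h \<in> module_hom k M N. bij_betw h (carrier M) (carrier N)}"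

text \<open>All functions \<open>S \<rightarrow> k\<close>, i.e. the dual \<open>(kS)\<^sup>*\<close> of the free module on \<open>S\<close>.\<close>

definition fun_module :: "('k, 'r) ring_scheme \<Rightarrow> 's set \<Rightarrow> ('k, 's \<Rightarrow> 'k) module" where
  "fun_module k S =
     \<lparr>carrier = S \<rightarrow>\<^sub>E carrier k, mult = undefined, one = undefined,
      zero = (\<lambda>s\<in>S. \<zero>\<^bsub>k\<^esub>), add = (\<lambda>u v. \<lambda>s\<in>S. u s \<oplus>\<^bsub>k\<^esub> v s),
      smult = (\<lambda>r u. \<lambda>s\<in>S. r \<otimes>\<^bsub>k\<^esub> u s)\<rparr>"

text \<open>The free module \<open>kS\<close>: an element is its family of coefficients.\<close>

definition free_module :: "('k, 'r) ring_scheme \<Rightarrow> 's set \<Rightarrow> ('k, 's \<Rightarrow> 'k) module" where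
  "free_module k S = (fun_module k S)
     \<lparr>carrier := {u \<in> S \<rightarrow>\<^sub>E carrier k. finite {s \<in> S. u s \<noteq> \<zero>\<^bsub>k\<^esub>}}\<rparr>"

definition basis_elem :: "('k, 'r) ring_scheme \<Rightarrow> 's set \<Rightarrow> 's \<Rightarrow> 's \<Rightarrow> 'k" where
  "basis_elem k S s = (\<lambda>t\<in>S. if t = s then \<one>\<^bsub>k\<^esub> else \<zero>\<^bsub>k\<^esub>)"

text \<open>The linear extension \<open>kS \<rightarrow> kT\<close> of a map \<open>\<phi> : S \<rightarrow> T\<close>.\<close>

definition free_map ::
  "('k, 'r) ring_scheme \<Rightarrow> 's set \<Rightarrow> 't set \<Rightarrow> ('s \<Rightarrow> 't) \<Rightarrow> ('s \<Rightarrow> 'k) \<Rightarrow> 't \<Rightarrow> 'k" where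
  "free_map k S T \<phi> u = (\<lambda>t\<in>T. \<Oplus>\<^bsub>k\<^esub>s\<in>{s \<in> S. \<phi> s = t \<and> u s \<noteq> \<zero>\<^bsub>k\<^esub>}. u s)"

definition quotient_module ::
  "('k, 'v, 'a) module_scheme \<Rightarrow> 'v set \<Rightarrow> ('k, 'v set) module" where
  "quotient_module M N =
     \<lparr>carrier = a_rcosets\<^bsub>M\<^esub> N, mult = undefined, one = undefined,
      zero = N, add = set_add M,
      smult = (\<lambda>r X. \<Union>v\<in>X. N +>\<^bsub>M\<^esub> (r \<odot>\<^bsub>M\<^esub> v))\<rparr>"

definition kernel_module ::
  "('k, 'v) module \<Rightarrow> ('k, 'w) module \<Rightarrow> ('v \<Rightarrow> 'w) \<Rightarrow> ('k, 'v) module" where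
  "kernel_module M N h = M\<lparr>carrier := a_kernel M N h\<rparr>"

text \<open>For a matrix \<open>A\<close> with rows indexed by \<open>R\<close> and columns indexed by \<open>S\<close>, its transpose
  maps functions on the rows to functions on the columns.\<close>

definition transpose_map ::
  "('k, 'r) ring_scheme \<Rightarrow> 'i set \<Rightarrow> 'j set \<Rightarrow> ('i \<Rightarrow> 'j \<Rightarrow> 'k) \<Rightarrow> ('i \<Rightarrow> 'k) \<Rightarrow> 'j \<Rightarrow> 'k" where
  "transpose_map k R S A \<rho> = (\<lambda>j\<in>S. \<Oplus>\<^bsub>k\<^esub>i\<in>R. A i j \<otimes>\<^bsub>k\<^esub> \<rho> i)"


section \<open>Modules over a category\<close>

record ('o, 'm, 'k, 'v) cmodule =
  obj_map :: "'o \<Rightarrow> ('k, 'v) module"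
  arr_map :: "'m \<Rightarrow> 'v \<Rightarrow> 'v"

text \<open>Covariant functors from \<open>C\<close> to \<open>k\<close>-modules.\<close>

definition is_cmodule ::
  "('k, 'r) ring_scheme \<Rightarrow> ('o, 'm, 'z) category_scheme \<Rightarrow> ('o, 'm, 'k, 'v) cmodule \<Rightarrow> bool" where
  "is_cmodule k C V \<longleftrightarrow>
     (\<forall>x\<in>Obj C. module k (obj_map V x)) \<and>
     (\<forall>f\<in>Arr C. arr_map V f \<in> module_hom k (obj_map V (src C f)) (obj_map V (tgt C f))) \<and>
     (\<forall>x\<in>Obj C. \<forall>v\<in>carrier (obj_map V x). arr_map V (idt C x) v = v) \<and>
     (\<forall>f\<in>Arr C. \<forall>g\<in>Arr C. src C g = tgt C f \<longrightarrow>
        (\<forall>v\<in>carrier (obj_map V (src C f)). arr_map V (g \<cdot>\<^bsub>C\<^esub> f) v = arr_map V g (arr_map V f v)))"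

definition is_csubmodule ::
  "('k, 'r) ring_scheme \<Rightarrow> ('o, 'm, 'z) category_scheme \<Rightarrow> ('o, 'm, 'k, 'v) cmodule
     \<Rightarrow> ('o \<Rightarrow> 'v set) \<Rightarrow> bool" where
  "is_csubmodule k C V N \<longleftrightarrow>
     (\<forall>x\<in>Obj C. submodule (N x) k (obj_map V x)) \<and>
     (\<forall>f\<in>Arr C. \<forall>v\<in>N (src C f). arr_map V f v \<in> N (tgt C f))"

text \<open>The submodule generated by a set of elements; a pair \<open>(z, v)\<close> stands for
  \<open>v \<in> V(z)\<close>.\<close>

definition generated_csubmodule ::
  "('k, 'r) ring_scheme \<Rightarrow> ('o, 'm, 'z) category_scheme \<Rightarrow> ('o, 'm, 'k, 'v) cmodule
     \<Rightarrow> ('o \<times> 'v) set \<Rightarrow> 'o \<Rightarrow> 'v set" where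
  "generated_csubmodule k C V G x =
     \<Inter> {N x | N. is_csubmodule k C V N \<and> (\<forall>(z, v)\<in>G. v \<in> N z)}"

definition quotient_cmodule ::
  "('o, 'm, 'z) category_scheme \<Rightarrow> ('o, 'm, 'k, 'v) cmodule \<Rightarrow> ('o \<Rightarrow> 'v set)
     \<Rightarrow> ('o, 'm, 'k, 'v set) cmodule" where
  "quotient_cmodule C V N =
     \<lparr>obj_map = (\<lambda>x. quotient_module (obj_map V x) (N x)),
      arr_map = (\<lambda>f X. \<Union>v\<in>X. N (tgt C f) +>\<^bsub>obj_map V (tgt C f)\<^esub> arr_map V f v)\<rparr>"

text \<open>Natural transformations are represented by families that are \<open>undefined\<close> outside
  the objects of \<open>C\<close>, and whose components are \<open>undefined\<close> outside the carriers, so that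
  equal transformations are equal as functions.\<close>

definition nat_transf ::
  "('k, 'r) ring_scheme \<Rightarrow> ('o, 'm, 'z) category_scheme \<Rightarrow> ('o, 'm, 'k, 'v) cmodule
     \<Rightarrow> ('o, 'm, 'k, 'w) cmodule \<Rightarrow> ('o \<Rightarrow> 'v \<Rightarrow> 'w) set" where
  "nat_transf k C V W =
     {\<eta> \<in> (\<Pi>\<^sub>E x\<in>Obj C. module_hom k (obj_map V x) (obj_map W x) \<inter> extensional (carrier (obj_map V x))).
      \<forall>f\<in>Arr C. \<forall>v\<in>carrier (obj_map V (src C f)).
        \<eta> (tgt C f) (arr_map V f v) = arr_map W f (\<eta> (src C f) v)}"

definition Hom_cmodule ::
  "('k, 'r) ring_scheme \<Rightarrow> ('o, 'm, 'z) category_scheme \<Rightarrow> ('o, 'm, 'k, 'v) cmodule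
     \<Rightarrow> ('o, 'm, 'k, 'w) cmodule \<Rightarrow> ('k, 'o \<Rightarrow> 'v \<Rightarrow> 'w) module" where
  "Hom_cmodule k C V W =
     \<lparr>carrier = nat_transf k C V W, mult = undefined, one = undefined,
      zero = (\<lambda>x\<in>Obj C. \<lambda>v\<in>carrier (obj_map V x). \<zero>\<^bsub>obj_map W x\<^esub>),
      add = (\<lambda>\<eta> \<theta>. \<lambda>x\<in>Obj C. \<lambda>v\<in>carrier (obj_map V x). \<eta> x v \<oplus>\<^bsub>obj_map W x\<^esub> \<theta> x v),
      smult = (\<lambda>r \<eta>. \<lambda>x\<in>Obj C. \<lambda>v\<in>carrier (obj_map V x). r \<odot>\<^bsub>obj_map W x\<^esub> \<eta> x v)\<rparr>"


section \<open>Standard modules\<close>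

definition representable ::
  "('k, 'r) ring_scheme \<Rightarrow> ('o, 'm, 'z) category_scheme \<Rightarrow> 'o \<Rightarrow> ('o, 'm, 'k, 'm \<Rightarrow> 'k) cmodule"
  where "representable k C x =
     \<lparr>obj_map = (\<lambda>y. free_module k (homset C x y)),
      arr_map = (\<lambda>f. free_map k (homset C x (src C f)) (homset C x (tgt C f)) (\<lambda>g. f \<cdot>\<^bsub>C\<^esub> g))\<rparr>"

definition standard_rel ::
  "('k, 'r) ring_scheme \<Rightarrow> ('o, 'm, 'z) reedy_scheme \<Rightarrow> 'o \<Rightarrow> 'o \<Rightarrow> ('m \<Rightarrow> 'k) set" where
  "standard_rel k C x = generated_csubmodule k C (representable k C x)
     {(z, basis_elem k (homset C x z) g) | z g. g \<in> minus_hom C x z \<and> deg C z < deg C x}"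

definition standard_module ::
  "('k, 'r) ring_scheme \<Rightarrow> ('o, 'm, 'z) reedy_scheme \<Rightarrow> 'o \<Rightarrow> ('o, 'm, 'k, ('m \<Rightarrow> 'k) set) cmodule"
  where "standard_module k C x = quotient_cmodule C (representable k C x) (standard_rel k C x)"

text \<open>The class in \<open>\<Delta>\<^sub>x(y)\<close> of an element of \<open>P\<^sub>x(y)\<close>.\<close>

definition standard_class ::
  "('k, 'r) ring_scheme \<Rightarrow> ('o, 'm, 'z) reedy_scheme \<Rightarrow> 'o \<Rightarrow> 'o \<Rightarrow> ('m \<Rightarrow> 'k) \<Rightarrow> ('m \<Rightarrow> 'k) set"
  where "standard_class k C x y u =
     standard_rel k C x y +>\<^bsub>obj_map (representable k C x) y\<^esub> u"


text \<open>\<open>\<Delta>\<^sub>x\<close> is indeed a functor to \<open>k\<close>-modules.\<close>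

lemma fun_module_module:
  assumes "cring k" shows "module k (fun_module k S)"
proof -
  interpret k: cring k by fact
  show ?thesis
  proof (rule moduleI[OF assms])
    show "abelian_group (fun_module k S)"
    proof (rule abelian_groupI)
      fix u assume u: "u \<in> carrier (fun_module k S)"
      then have "(\<lambda>s\<in>S. \<ominus>\<^bsub>k\<^esub> u s) \<in> carrier (fun_module k S)"
        by (auto simp: fun_module_def)
      moreover have "(\<lambda>s\<in>S. \<ominus>\<^bsub>k\<^esub> u s) \<oplus>\<^bsub>fun_module k S\<^esub> u = \<zero>\<^bsub>fun_module k S\<^esub>"
        using u by (auto simp: fun_module_def fun_eq_iff k.l_neg PiE_def Pi_def)
      ultimately show "\<exists>v\<in>carrier (fun_module k S). v \<oplus>\<^bsub>fun_module k S\<^esub> u = \<zero>\<^bsub>fun_module k S\<^esub>"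
        by blast
    qed (auto simp: fun_module_def fun_eq_iff PiE_def Pi_def extensional_def k.a_ac)
  qed (auto simp: fun_module_def fun_eq_iff PiE_def Pi_def extensional_def k.l_distr k.r_distr k.m_assoc)
qed

lemma free_module_finite:
  "finite S \<Longrightarrow> free_module k S = fun_module k S"
  by (simp add: free_module_def fun_module_def)

lemma free_map_finite:
  assumes "cring k" "finite S" "u \<in> S \<rightarrow>\<^sub>E carrier k"
  shows "free_map k S T \<phi> u = (\<lambda>t\<in>T. \<Oplus>\<^bsub>k\<^esub>s\<in>{s \<in> S. \<phi> s = t}. u s)"
proof -
  interpret k: cring k by fact
  have "(\<Oplus>\<^bsub>k\<^esub>s\<in>{s \<in> S. \<phi> s = t \<and> u s \<noteq> \<zero>\<^bsub>k\<^esub>}. u s) = (\<Oplus>\<^bsub>k\<^esub>s\<in>{s \<in> S. \<phi> s = t}. u s)" for t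
    using assms by (intro k.add.finprod_mono_neutral_cong_left) auto
  then show ?thesis by (simp add: free_map_def)
qed

lemma free_map_hom:
  assumes "cring k" "finite S" "finite T"
  shows "free_map k S T \<phi> \<in> module_hom k (free_module k S) (free_module k T)"
proof -
  interpret k: cring k by fact
  interpret M: module k "fun_module k S" using assms(1) by (rule fun_module_module)
  have car: "carrier (fun_module k S) = S \<rightarrow>\<^sub>E carrier k" by (simp add: fun_module_def)
  have c: "free_map k S T \<phi> u \<in> T \<rightarrow>\<^sub>E carrier k" if "u \<in> S \<rightarrow>\<^sub>E carrier k" for u
    using that assms by (auto simp: free_map_finite intro!: k.finsum_closed)
  have a: "free_map k S T \<phi> (u \<oplus>\<^bsub>fun_module k S\<^esub> v)
      = free_map k S T \<phi> u \<oplus>\<^bsub>fun_module k T\<^esub> free_map k S T \<phi> v"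
    if u: "u \<in> S \<rightarrow>\<^sub>E carrier k" and v: "v \<in> S \<rightarrow>\<^sub>E carrier k" for u v
  proof -
    have uv: "u \<oplus>\<^bsub>fun_module k S\<^esub> v \<in> S \<rightarrow>\<^sub>E carrier k"
      using M.a_closed u v car by simp
    have "(\<Oplus>\<^bsub>k\<^esub>s\<in>{s \<in> S. \<phi> s = t}. (u \<oplus>\<^bsub>fun_module k S\<^esub> v) s)
       = (\<Oplus>\<^bsub>k\<^esub>s\<in>{s \<in> S. \<phi> s = t}. u s \<oplus>\<^bsub>k\<^esub> v s)" for t
      using u v by (intro k.finsum_cong') (auto simp: fun_module_def)
    moreover have "\<dots> t = (\<Oplus>\<^bsub>k\<^esub>s\<in>{s \<in> S. \<phi> s = t}. u s) \<oplus>\<^bsub>k\<^esub> (\<Oplus>\<^bsub>k\<^esub>s\<in>{s \<in> S. \<phi> s = t}. v s)" for t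
      using u v by (intro k.finsum_addf) auto
    ultimately show ?thesis
      using assms u v uv by (simp add: free_map_finite) (auto simp: fun_module_def)
  qed
  have m: "free_map k S T \<phi> (r \<odot>\<^bsub>fun_module k S\<^esub> u) = r \<odot>\<^bsub>fun_module k T\<^esub> free_map k S T \<phi> u"
    if r: "r \<in> carrier k" and u: "u \<in> S \<rightarrow>\<^sub>E carrier k" for r u
  proof -
    have ru: "r \<odot>\<^bsub>fun_module k S\<^esub> u \<in> S \<rightarrow>\<^sub>E carrier k"
      using M.smult_closed r u car by simp
    have "(\<Oplus>\<^bsub>k\<^esub>s\<in>{s \<in> S. \<phi> s = t}. (r \<odot>\<^bsub>fun_module k S\<^esub> u) s)
       = (\<Oplus>\<^bsub>k\<^esub>s\<in>{s \<in> S. \<phi> s = t}. r \<otimes>\<^bsub>k\<^esub> u s)" for t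
      using r u by (intro k.finsum_cong') (auto simp: fun_module_def)
    moreover have "\<dots> t = r \<otimes>\<^bsub>k\<^esub> (\<Oplus>\<^bsub>k\<^esub>s\<in>{s \<in> S. \<phi> s = t}. u s)" for t
      using assms r u by (intro k.finsum_rdistr[symmetric]) auto
    ultimately show ?thesis
      using assms r u ru by (simp add: free_map_finite) (auto simp: fun_module_def)
  qed
  show ?thesis
    using c a m assms by (auto simp: module_hom_def hom_def free_module_finite car)
       (auto simp: fun_module_def)
qed

lemma (in category) cmp_comp: "f \<in> Arr C \<Longrightarrow> g \<in> Arr C \<Longrightarrow> src C g = tgt C f \<Longrightarrow>
   g \<cdot> f \<in> Arr C \<and> src C (g \<cdot> f) = src C f \<and> tgt C (g \<cdot> f) = tgt C g"
  using cmp_homset[of f "src C f" "tgt C f" g "tgt C g"] by (auto simp: homset_def)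

lemma representable_cmodule:
  assumes "cring k" "generalized_reedy C" "x \<in> Obj C"
  shows "is_cmodule k C (representable k C x)"
proof -
  interpret k: cring k by fact
  interpret generalized_reedy C by fact
  have fin: "finite (homset C x y)" if "y \<in> Obj C" for y
    using that assms finite_homset by blast
  have hom: "f \<cdot>\<^bsub>C\<^esub> g \<in> homset C x (tgt C f)" if "f \<in> Arr C" "g \<in> homset C x (src C f)" for f g
    using that cmp_homset[of g x "src C f" f "tgt C f"] by (auto simp: homset_def)
  have 1: "module k (obj_map (representable k C x) y)" if "y \<in> Obj C" for y
    using that fin assms by (simp add: representable_def free_module_finite fun_module_module)
  have 2: "arr_map (representable k C x) f \<in> module_hom k (obj_map (representable k C x) (src C f)) (obj_map (representable k C x) (tgt C f))"
    if "f \<in> Arr C" for f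
    using that fin assms src_Obj tgt_Obj by (simp add: representable_def free_map_hom)
  have 3: "arr_map (representable k C x) (idt C y) v = v"
    if y: "y \<in> Obj C" and v: "v \<in> carrier (obj_map (representable k C x) y)" for y v
  proof -
    have i: "src C (idt C y) = y" "tgt C (idt C y) = y"
      using idt_homset y by (auto simp: homset_def)
    have v': "v \<in> homset C x y \<rightarrow>\<^sub>E carrier k"
      using v y fin by (simp add: representable_def free_module_finite fun_module_def)
    have "{s \<in> homset C x y. idt C y \<cdot>\<^bsub>C\<^esub> s = t} = {t}" if "t \<in> homset C x y" for t
      using that cmp_idt_left by auto
    then have "(\<lambda>t\<in>homset C x y. \<Oplus>\<^bsub>k\<^esub>s\<in>{s \<in> homset C x y. idt C y \<cdot>\<^bsub>C\<^esub> s = t}. v s) = v"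
      using v' by (auto simp: fun_eq_iff PiE_def Pi_def extensional_def)
    then show ?thesis
      using i v' fin y assms by (simp add: representable_def free_map_finite)
  qed
  have 4: "arr_map (representable k C x) (g \<cdot>\<^bsub>C\<^esub> f) v = arr_map (representable k C x) g (arr_map (representable k C x) f v)"
    if f: "f \<in> Arr C" and g: "g \<in> Arr C" and gf: "src C g = tgt C f"
      and v: "v \<in> carrier (obj_map (representable k C x) (src C f))" for f g v
  proof -
    let ?S = "homset C x (src C f)" and ?T = "homset C x (tgt C f)" and ?U = "homset C x (tgt C g)"
    have fS: "finite ?S" "finite ?T" using fin src_Obj tgt_Obj f by auto
    have v': "v \<in> ?S \<rightarrow>\<^sub>E carrier k"
      using v fS by (simp add: representable_def free_module_finite fun_module_def)
    have w: "free_map k ?S ?T ((\<cdot>\<^bsub>C\<^esub>) f) v \<in> ?T \<rightarrow>\<^sub>E carrier k"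
      using v' fS assms by (auto simp: free_map_finite intro!: k.finsum_closed)
    have "(\<Oplus>\<^bsub>k\<^esub>s\<in>{s \<in> ?S. (g \<cdot>\<^bsub>C\<^esub> f) \<cdot>\<^bsub>C\<^esub> s = t}. v s)
        = (\<Oplus>\<^bsub>k\<^esub>s\<in>{s \<in> ?T. g \<cdot>\<^bsub>C\<^esub> s = t}. free_map k ?S ?T ((\<cdot>\<^bsub>C\<^esub>) f) v s)" for t
    proof -
      have "(\<Oplus>\<^bsub>k\<^esub>s\<in>{s \<in> ?T. g \<cdot>\<^bsub>C\<^esub> s = t}. free_map k ?S ?T ((\<cdot>\<^bsub>C\<^esub>) f) v s)
         = (\<Oplus>\<^bsub>k\<^esub>s\<in>{s \<in> ?T. g \<cdot>\<^bsub>C\<^esub> s = t}. \<Oplus>\<^bsub>k\<^esub>r\<in>{r \<in> ?S. f \<cdot>\<^bsub>C\<^esub> r = s}. v r)"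
        using v' fS assms by (intro k.finsum_cong') (auto simp: free_map_finite intro!: k.finsum_closed)
      also have "\<dots> = (\<Oplus>\<^bsub>k\<^esub>r\<in>(\<Union>s\<in>{s \<in> ?T. g \<cdot>\<^bsub>C\<^esub> s = t}. {r \<in> ?S. f \<cdot>\<^bsub>C\<^esub> r = s}). v r)"
        using v' fS by (intro k.add.finprod_UN_disjoint[symmetric]) (auto simp: pairwise_def disjnt_def)
      also have "(\<Union>s\<in>{s \<in> ?T. g \<cdot>\<^bsub>C\<^esub> s = t}. {r \<in> ?S. f \<cdot>\<^bsub>C\<^esub> r = s})
          = {s \<in> ?S. (g \<cdot>\<^bsub>C\<^esub> f) \<cdot>\<^bsub>C\<^esub> s = t}"
        using hom f g gf cmp_assoc[of _ x "src C f" f "tgt C f" g "tgt C g"]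
        by (auto simp: homset_def)
      finally show ?thesis by simp
    qed
    moreover have "src C (g \<cdot>\<^bsub>C\<^esub> f) = src C f" "tgt C (g \<cdot>\<^bsub>C\<^esub> f) = tgt C g"
      using cmp_comp f g gf by blast+
    ultimately show ?thesis
      using v' w fS assms gf by (simp add: representable_def free_map_finite)
  qed
  show ?thesis using 1 2 3 4 by (simp add: is_cmodule_def)
qed

lemma module_hom_zero_neg:
  assumes "module k M" "module k N" "h \<in> module_hom k M N"
  shows "h \<in> carrier M \<rightarrow> carrier N" "h \<zero>\<^bsub>M\<^esub> = \<zero>\<^bsub>N\<^esub>"
    "\<And>u v. u \<in> carrier M \<Longrightarrow> v \<in> carrier M \<Longrightarrow> h (u \<oplus>\<^bsub>M\<^esub> v) = h u \<oplus>\<^bsub>N\<^esub> h v"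
    "\<And>r v. r \<in> carrier k \<Longrightarrow> v \<in> carrier M \<Longrightarrow> h (r \<odot>\<^bsub>M\<^esub> v) = r \<odot>\<^bsub>N\<^esub> h v"
proof -
  interpret M: module k M by fact
  interpret N: module k N by fact
  show a: "h \<in> carrier M \<rightarrow> carrier N" "\<And>u v. u \<in> carrier M \<Longrightarrow> v \<in> carrier M \<Longrightarrow> h (u \<oplus>\<^bsub>M\<^esub> v) = h u \<oplus>\<^bsub>N\<^esub> h v"
    "\<And>r v. r \<in> carrier k \<Longrightarrow> v \<in> carrier M \<Longrightarrow> h (r \<odot>\<^bsub>M\<^esub> v) = r \<odot>\<^bsub>N\<^esub> h v"
    using assms(3) by (auto simp: module_hom_def hom_def)
  have "h (\<zero>\<^bsub>k\<^esub> \<odot>\<^bsub>M\<^esub> \<zero>\<^bsub>M\<^esub>) = \<zero>\<^bsub>k\<^esub> \<odot>\<^bsub>N\<^esub> h \<zero>\<^bsub>M\<^esub>" by (rule a) auto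
  moreover have "h \<zero>\<^bsub>M\<^esub> \<in> carrier N" using a(1) by blast
  ultimately show "h \<zero>\<^bsub>M\<^esub> = \<zero>\<^bsub>N\<^esub>" by simp
qed

lemma generated_csubmodule_is_csubmodule:
  assumes V: "is_cmodule k C V" and C: "category C"
    and G: "\<forall>(z, v)\<in>G. z \<in> Obj C \<and> v \<in> carrier (obj_map V z)"
  shows "is_csubmodule k C V (generated_csubmodule k C V G)"
proof -
  interpret category C by fact
  let ?P = "\<lambda>N. is_csubmodule k C V N \<and> (\<forall>(z, v)\<in>G. v \<in> N z)"
  have top: "?P (\<lambda>x. carrier (obj_map V x))"
    using V G module.carrier_is_submodule src_Obj tgt_Obj
    by (fastforce simp: is_cmodule_def is_csubmodule_def module_hom_def hom_def)
  have mem: "v \<in> generated_csubmodule k C V G x \<longleftrightarrow> (\<forall>N. ?P N \<longrightarrow> v \<in> N x)" for v x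
    by (auto simp: generated_csubmodule_def)
  have "submodule (generated_csubmodule k C V G x) k (obj_map V x)" if x: "x \<in> Obj C" for x
  proof -
    interpret M: module k "obj_map V x" using V x by (simp add: is_cmodule_def)
    have s: "submodule (N x) k (obj_map V x)" if "?P N" for N
      using that x by (simp add: is_csubmodule_def)
    note E = M.submoduleE[OF s]
    have z: "\<zero>\<^bsub>obj_map V x\<^esub> \<in> N x" if "?P N" for N
      using s[OF that] subgroup.one_closed[of "N x" "add_monoid (obj_map V x)"] by (auto simp: submodule_def)
    show ?thesis
    proof (rule M.submoduleI)
      show "generated_csubmodule k C V G x \<subseteq> carrier (obj_map V x)"
        using top by (auto simp: mem)
      show "\<zero>\<^bsub>obj_map V x\<^esub> \<in> generated_csubmodule k C V G x"
        unfolding mem using z by blast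
      show "\<ominus>\<^bsub>obj_map V x\<^esub> a \<in> generated_csubmodule k C V G x"
        if "a \<in> generated_csubmodule k C V G x" for a
        using that E(3) unfolding mem by blast
      show "a \<oplus>\<^bsub>obj_map V x\<^esub> b \<in> generated_csubmodule k C V G x"
        if "a \<in> generated_csubmodule k C V G x" "b \<in> generated_csubmodule k C V G x" for a b
        using that E(5) unfolding mem by blast
      show "r \<odot>\<^bsub>obj_map V x\<^esub> a \<in> generated_csubmodule k C V G x"
        if "r \<in> carrier k" "a \<in> generated_csubmodule k C V G x" for r a
        using that E(4) unfolding mem by blast
    qed
  qed
  moreover have "arr_map V f v \<in> generated_csubmodule k C V G (tgt C f)"
    if "f \<in> Arr C" "v \<in> generated_csubmodule k C V G (src C f)" for f v
    using that unfolding mem by (auto simp: is_csubmodule_def)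
  ultimately show ?thesis by (simp add: is_csubmodule_def)
qed

lemma
  assumes "module k M" "submodule N k M"
  shows quotient_module_module: "module k (quotient_module M N)"
    and quotient_smult: "\<And>r v. r \<in> carrier k \<Longrightarrow> v \<in> carrier M \<Longrightarrow>
       r \<odot>\<^bsub>quotient_module M N\<^esub> (N +>\<^bsub>M\<^esub> v) = N +>\<^bsub>M\<^esub> (r \<odot>\<^bsub>M\<^esub> v)"
    and quotient_add: "\<And>u v. u \<in> carrier M \<Longrightarrow> v \<in> carrier M \<Longrightarrow>
       (N +>\<^bsub>M\<^esub> u) \<oplus>\<^bsub>quotient_module M N\<^esub> (N +>\<^bsub>M\<^esub> v) = N +>\<^bsub>M\<^esub> (u \<oplus>\<^bsub>M\<^esub> v)"
proof -
  interpret M: module k M by fact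
  interpret N: abelian_subgroup N M
    using assms by (intro abelian_subgroupI3 additive_subgroup.intro M.abelian_group_axioms) (auto simp: submodule_def)
  have sm: "r \<odot>\<^bsub>M\<^esub> n \<in> N" if "r \<in> carrier k" "n \<in> N" for r n
    using assms(2) that by (rule submodule.smult_closed)
  let ?Q = "quotient_module M N"
  have car: "carrier ?Q = (\<lambda>v. N +>\<^bsub>M\<^esub> v) ` carrier M"
    by (auto simp: quotient_module_def A_RCOSETS_def')
  show smult: "r \<odot>\<^bsub>?Q\<^esub> (N +>\<^bsub>M\<^esub> v) = N +>\<^bsub>M\<^esub> (r \<odot>\<^bsub>M\<^esub> v)"
    if r: "r \<in> carrier k" and v: "v \<in> carrier M" for r v
  proof -
    have "N +>\<^bsub>M\<^esub> (r \<odot>\<^bsub>M\<^esub> w) = N +>\<^bsub>M\<^esub> (r \<odot>\<^bsub>M\<^esub> v)" if w: "w \<in> N +>\<^bsub>M\<^esub> v" for w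
    proof -
      obtain n where n: "n \<in> N" "w = n \<oplus>\<^bsub>M\<^esub> v" using w by (auto simp: a_r_coset_def')
      then have "r \<odot>\<^bsub>M\<^esub> w = r \<odot>\<^bsub>M\<^esub> n \<oplus>\<^bsub>M\<^esub> r \<odot>\<^bsub>M\<^esub> v"
        using r v N.a_subset by (auto intro!: M.smult_r_distr)
      then have "r \<odot>\<^bsub>M\<^esub> w \<in> N +>\<^bsub>M\<^esub> (r \<odot>\<^bsub>M\<^esub> v)"
        using sm[OF r n(1)] by (auto simp: a_r_coset_def')
      then show ?thesis using r v N.a_repr_independence' by blast
    qed
    moreover have "v \<in> N +>\<^bsub>M\<^esub> v" using v N.a_rcos_self by blast
    ultimately have "(\<Union>w\<in>N +>\<^bsub>M\<^esub> v. N +>\<^bsub>M\<^esub> (r \<odot>\<^bsub>M\<^esub> w)) = N +>\<^bsub>M\<^esub> (r \<odot>\<^bsub>M\<^esub> v)"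
      by blast
    then show ?thesis by (simp add: quotient_module_def)
  qed
  show add: "(N +>\<^bsub>M\<^esub> u) \<oplus>\<^bsub>?Q\<^esub> (N +>\<^bsub>M\<^esub> v) = N +>\<^bsub>M\<^esub> (u \<oplus>\<^bsub>M\<^esub> v)"
    if "u \<in> carrier M" "v \<in> carrier M" for u v
    using that N.a_rcos_sum by (simp add: quotient_module_def)
  have zero: "\<zero>\<^bsub>?Q\<^esub> = N +>\<^bsub>M\<^esub> \<zero>\<^bsub>M\<^esub>"
    using M.a_coset_add_zero N.a_subset by (simp add: quotient_module_def)
  show "module k ?Q"
  proof (rule moduleI)
    show "abelian_group ?Q"
    proof (rule abelian_groupI)
      fix X assume "X \<in> carrier ?Q"
      then obtain v where v: "v \<in> carrier M" "X = N +>\<^bsub>M\<^esub> v" by (auto simp: car)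
      then have "N +>\<^bsub>M\<^esub> (\<ominus>\<^bsub>M\<^esub> v) \<in> carrier ?Q"
         "(N +>\<^bsub>M\<^esub> (\<ominus>\<^bsub>M\<^esub> v)) \<oplus>\<^bsub>?Q\<^esub> X = \<zero>\<^bsub>?Q\<^esub>"
        by (auto simp: car add zero M.l_neg)
      then show "\<exists>Y\<in>carrier ?Q. Y \<oplus>\<^bsub>?Q\<^esub> X = \<zero>\<^bsub>?Q\<^esub>" by blast
    qed (auto simp: car add zero M.a_ac)
  qed (auto simp: car add smult M.smult_l_distr M.smult_r_distr M.smult_assoc1 M.cring_axioms)
qed

lemma quotient_act:
  assumes V: "is_cmodule k C V" and C: "category C" and N: "is_csubmodule k C V N"
    and f: "f \<in> Arr C" and v: "v \<in> carrier (obj_map V (src C f))"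
  shows "arr_map (quotient_cmodule C V N) f (N (src C f) +>\<^bsub>obj_map V (src C f)\<^esub> v)
    = N (tgt C f) +>\<^bsub>obj_map V (tgt C f)\<^esub> arr_map V f v"
proof -
  interpret category C by fact
  let ?x = "src C f" and ?y = "tgt C f"
  have m: "module k (obj_map V ?x)" "module k (obj_map V ?y)" and h: "arr_map V f \<in> module_hom k (obj_map V ?x) (obj_map V ?y)"
    using V f src_Obj tgt_Obj by (auto simp: is_cmodule_def)
  have s: "submodule (N ?x) k (obj_map V ?x)" "submodule (N ?y) k (obj_map V ?y)"
    using N f src_Obj tgt_Obj by (auto simp: is_csubmodule_def)
  interpret X: module k "obj_map V ?x" by fact
  interpret Y: module k "obj_map V ?y" by fact
  interpret NX: abelian_subgroup "N ?x" "obj_map V ?x"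
    using s by (intro abelian_subgroupI3 additive_subgroup.intro X.abelian_group_axioms) (auto simp: submodule_def)
  interpret NY: abelian_subgroup "N ?y" "obj_map V ?y"
    using s by (intro abelian_subgroupI3 additive_subgroup.intro Y.abelian_group_axioms) (auto simp: submodule_def)
  note h' = module_hom_zero_neg[OF m h]
  have "N ?y +>\<^bsub>obj_map V ?y\<^esub> arr_map V f w = N ?y +>\<^bsub>obj_map V ?y\<^esub> arr_map V f v" if w: "w \<in> N ?x +>\<^bsub>obj_map V ?x\<^esub> v" for w
  proof -
    obtain n where n: "n \<in> N ?x" "w = n \<oplus>\<^bsub>obj_map V ?x\<^esub> v" using w by (auto simp: a_r_coset_def')
    then have "arr_map V f w = arr_map V f n \<oplus>\<^bsub>obj_map V ?y\<^esub> arr_map V f v"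
      using v NX.a_subset h' by auto
    moreover have "arr_map V f n \<in> N ?y" using N f n by (auto simp: is_csubmodule_def)
    ultimately have "arr_map V f w \<in> N ?y +>\<^bsub>obj_map V ?y\<^esub> arr_map V f v" by (auto simp: a_r_coset_def')
    then show ?thesis using v h'(1) NY.a_repr_independence' by blast
  qed
  moreover have "v \<in> N ?x +>\<^bsub>obj_map V ?x\<^esub> v" using v NX.a_rcos_self by blast
  ultimately have "(\<Union>w\<in>N ?x +>\<^bsub>obj_map V ?x\<^esub> v. N ?y +>\<^bsub>obj_map V ?y\<^esub> arr_map V f w) = N ?y +>\<^bsub>obj_map V ?y\<^esub> arr_map V f v"
    by blast
  then show ?thesis by (simp add: quotient_cmodule_def)
qed

lemma quotient_cmodule_is_cmodule:
  assumes V: "is_cmodule k C V" and C: "category C" and N: "is_csubmodule k C V N"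
  shows "is_cmodule k C (quotient_cmodule C V N)"
proof -
  interpret category C by fact
  note q = quotient_act[OF assms]
  have obj_map: "obj_map (quotient_cmodule C V N) x = quotient_module (obj_map V x) (N x)" for x
    by (simp add: quotient_cmodule_def)
  have car: "carrier (quotient_module (obj_map V x) (N x)) = (\<lambda>v. N x +>\<^bsub>obj_map V x\<^esub> v) ` carrier (obj_map V x)" for x
    by (auto simp: quotient_module_def A_RCOSETS_def')
  have M: "module k (obj_map V x)" "submodule (N x) k (obj_map V x)" if "x \<in> Obj C" for x
    using that V N by (auto simp: is_cmodule_def is_csubmodule_def)
  note Q = quotient_module_module[OF M] quotient_smult[OF M] quotient_add[OF M]
  have 2: "arr_map (quotient_cmodule C V N) f \<in> module_hom k
       (quotient_module (obj_map V (src C f)) (N (src C f))) (quotient_module (obj_map V (tgt C f)) (N (tgt C f)))"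
    if f: "f \<in> Arr C" for f
  proof -
    interpret X: module k "obj_map V (src C f)" using M src_Obj f by blast
    interpret Y: module k "obj_map V (tgt C f)" using M tgt_Obj f by blast
    have h: "arr_map V f \<in> module_hom k (obj_map V (src C f)) (obj_map V (tgt C f))"
      using V f by (auto simp: is_cmodule_def)
    note h' = module_hom_zero_neg[OF X.module_axioms Y.module_axioms h]
    have c: "arr_map V f v \<in> carrier (obj_map V (tgt C f))" if "v \<in> carrier (obj_map V (src C f))" for v
      using h'(1) that by blast
    show ?thesis
      using f src_Obj[OF f] tgt_Obj[OF f] c
      by (auto simp: module_hom_def hom_def car q Q h')
  qed
  have i: "idt C x \<in> Arr C" "src C (idt C x) = x" "tgt C (idt C x) = x" if "x \<in> Obj C" for x
    using idt_homset that by (auto simp: homset_def)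
  have 3: "arr_map (quotient_cmodule C V N) (idt C x) X = X"
    if "x \<in> Obj C" "X \<in> carrier (quotient_module (obj_map V x) (N x))" for x X
    using that i[OF that(1)] q[of "idt C x"] V by (auto simp: car is_cmodule_def)
  have 4: "arr_map (quotient_cmodule C V N) (g \<cdot>\<^bsub>C\<^esub> f) X
       = arr_map (quotient_cmodule C V N) g (arr_map (quotient_cmodule C V N) f X)"
    if fg: "f \<in> Arr C" "g \<in> Arr C" "src C g = tgt C f"
      and X: "X \<in> carrier (quotient_module (obj_map V (src C f)) (N (src C f)))" for f g X
  proof -
    obtain v where v: "v \<in> carrier (obj_map V (src C f))" "X = N (src C f) +>\<^bsub>obj_map V (src C f)\<^esub> v"
      using X by (auto simp: car)
    have "arr_map V f v \<in> carrier (obj_map V (tgt C f))"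
      using V fg v by (auto simp: is_cmodule_def module_hom_def hom_def)
    then show ?thesis
      using fg v cmp_comp[OF fg] q[of f v] q[of "g \<cdot>\<^bsub>C\<^esub> f" v] q[of g "arr_map V f v"] V
      by (simp add: is_cmodule_def)
  qed
  show ?thesis
    unfolding is_cmodule_def obj_map using Q 2 3 4 by auto
qed

lemma standard_module_is_cmodule:
  assumes "cring k" "generalized_reedy C" "x \<in> Obj C"
  shows "is_cmodule k C (standard_module k C x)"
proof -
  interpret k: cring k by fact
  interpret generalized_reedy C by fact
  have "z \<in> Obj C \<and> basis_elem k (homset C x z) g \<in> carrier (obj_map (representable k C x) z)"
    if "g \<in> minus_hom C x z" for z g
    using that assms finite_homset tgt_Obj
    by (auto simp: minus_hom_def homset_def representable_def free_module_finite fun_module_def basis_elem_def)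
  then show ?thesis
    unfolding standard_module_def standard_rel_def
    by (intro quotient_cmodule_is_cmodule generated_csubmodule_is_csubmodule
       representable_cmodule assms category_axioms) auto
qed


section \<open>Fibers\<close>

definition unfactorizable :: "('o, 'm, 'z) reedy_scheme \<Rightarrow> 'o \<Rightarrow> 'o \<Rightarrow> 'm set" where
  "unfactorizable C y z = {h \<in> minus_hom C y z. \<not> iso_arrow C h \<and>
     (\<forall>g\<in>Minus C. \<forall>g'\<in>Minus C. src C g = tgt C g' \<longrightarrow> h = g \<cdot>\<^bsub>C\<^esub> g' \<longrightarrow>
        iso_arrow C g \<or> iso_arrow C g')}"

text \<open>\<open>U y z\<close> consists of one representative of each orbit of the left action of the
  automorphism group of \<open>z\<close>.\<close>

definition orbit_representatives ::
  "('o, 'm, 'z) reedy_scheme \<Rightarrow> ('o \<Rightarrow> 'o \<Rightarrow> 'm set) \<Rightarrow> bool" where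
  "orbit_representatives C U \<longleftrightarrow> (\<forall>y\<in>Obj C. \<forall>z\<in>Obj C.
     U y z \<subseteq> unfactorizable C y z \<and>
     (\<forall>h\<in>unfactorizable C y z. \<exists>!h'. h' \<in> U y z \<and> (\<exists>a\<in>Aut C z. h' = a \<cdot>\<^bsub>C\<^esub> h)))"

definition representatives_from ::
  "('o, 'm, 'z) reedy_scheme \<Rightarrow> ('o \<Rightarrow> 'o \<Rightarrow> 'm set) \<Rightarrow> 'o \<Rightarrow> 'm set" where
  "representatives_from C U y = (\<Union>z\<in>Obj C. U y z)"

definition fiber :: "('o, 'm, 'z) reedy_scheme \<Rightarrow> 'o \<Rightarrow> 'o \<Rightarrow> 'm \<Rightarrow> 'm \<Rightarrow> 'm set" where
  "fiber C x y h \<alpha> = {\<beta> \<in> plus_hom C x y. h \<cdot>\<^bsub>C\<^esub> \<beta> = \<alpha>}"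

definition fibers ::
  "('o, 'm, 'z) reedy_scheme \<Rightarrow> ('o \<Rightarrow> 'o \<Rightarrow> 'm set) \<Rightarrow> 'o \<Rightarrow> 'o \<Rightarrow> 'm set set" where
  "fibers C U x y =
     {fiber C x y h \<alpha> | h \<alpha>. h \<in> representatives_from C U y \<and> \<alpha> \<in> plus_hom C x (tgt C h)
        \<and> fiber C x y h \<alpha> \<noteq> {}}"

text \<open>The entries of \<open>M\<^bsub>x,y\<^esub>\<close>; they do not depend on \<open>x\<close> and \<open>y\<close>, only the index sets do.\<close>

definition fiber_matrix :: "('k, 'r) ring_scheme \<Rightarrow> 'm \<Rightarrow> 'm set \<Rightarrow> 'k" where
  "fiber_matrix k f F = (if f \<in> F then \<one>\<^bsub>k\<^esub> else \<zero>\<^bsub>k\<^esub>)"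

definition fiber_transpose ::
  "('k, 'r) ring_scheme \<Rightarrow> ('o, 'm, 'z) reedy_scheme \<Rightarrow> ('o \<Rightarrow> 'o \<Rightarrow> 'm set) \<Rightarrow> 'o \<Rightarrow> 'o
     \<Rightarrow> ('m \<Rightarrow> 'k) \<Rightarrow> 'm set \<Rightarrow> 'k" where
  "fiber_transpose k C U x y =
     transpose_map k (plus_hom C x y) (fibers C U x y) (fiber_matrix k)"

definition fiber_kernel ::
  "('k, 'r) ring_scheme \<Rightarrow> ('o, 'm, 'z) reedy_scheme \<Rightarrow> ('o \<Rightarrow> 'o \<Rightarrow> 'm set) \<Rightarrow> 'o \<Rightarrow> 'o
     \<Rightarrow> ('k, 'm \<Rightarrow> 'k) module" where
  "fiber_kernel k C U x y =
     kernel_module (fun_module k (plus_hom C x y)) (fun_module k (fibers C U x y))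
       (fiber_transpose k C U x y)"

lemma fiber_transpose_apply:
  assumes "cring k" "generalized_reedy C" "x \<in> Obj C" "y \<in> Obj C"
    and "\<rho> \<in> plus_hom C x y \<rightarrow>\<^sub>E carrier k" "F \<in> fibers C U x y"
  shows "fiber_transpose k C U x y \<rho> F = (\<Oplus>\<^bsub>k\<^esub>f\<in>F. \<rho> f)"
proof -
  interpret k: cring k by fact
  interpret generalized_reedy C by fact
  have fin: "finite (plus_hom C x y)"
    using finite_homset assms by (simp add: plus_hom_def)
  have sub: "F \<subseteq> plus_hom C x y"
    using assms by (auto simp: fibers_def fiber_def)
  have rho: "\<rho> f \<in> carrier k" if "f \<in> plus_hom C x y" for f
    using assms that by auto
  have "fiber_transpose k C U x y \<rho> F = (\<Oplus>\<^bsub>k\<^esub>f\<in>plus_hom C x y. if f \<in> F then \<rho> f else \<zero>\<^bsub>k\<^esub>)"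
    using assms rho
    by (auto simp: fiber_transpose_def transpose_map_def fiber_matrix_def intro!: k.finsum_cong')
  also have "\<dots> = (\<Oplus>\<^bsub>k\<^esub>f\<in>F. \<rho> f)"
    using fin sub rho
    by (intro k.add.finprod_mono_neutral_cong_right) auto
  finally show ?thesis .
qed

end

theory Submission
  imports Defs
begin

text \<open>Let \<open>e\<^sub>y \<in> \<Delta>\<^sub>y(y)\<close> be the class of the identity. By the Yoneda lemma a morphism out of
  \<open>P\<^sub>y\<close> is the choice of the image of the identity, so evaluation at \<open>e\<^sub>y\<close> identifies
  \<open>Hom(\<Delta>\<^sub>y, V)\<close> with the set of those \<open>v \<in> V(y)\<close> that every degree-lowering morphism of \<open>C\<^sup>-\<close>
  sends to zero (lemmas \<open>evaluation_at_generator_inj\<close> and \<open>evaluation_at_generator_image\<close>). It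
  remains to describe these elements for \<open>V = \<Delta>\<^sub>x\<close>.

  The key fact about the category is a cancellation law: if \<open>f s\<close> lies in \<open>C\<^sup>+\<close>, then so does \<open>s\<close>
  (\<open>plus_cancel_left\<close>). Therefore the morphisms outside \<open>C\<^sup>+\<close> span a submodule of
  \<open>P\<^sub>x\<close>, and factorization shows that this is the submodule that defines \<open>\<Delta>\<^sub>x\<close>
  (\<open>standard_rel_eq\<close>). So \<open>\<Delta>\<^sub>x(y)\<close> is free on \<open>C\<^sup>+(x,y)\<close>; its elements are the functions
  \<open>\<rho>\<close> on that set. A morphism \<open>h : y \<rightarrow> z\<close> acts on them by pushing \<open>\<rho>\<close> forward
  along \<open>\<beta> \<mapsto> h \<beta>\<close> and forgetting the values outside \<open>C\<^sup>+\<close>. Hence \<open>h\<close> kills \<open>\<rho>\<close> if and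
  only if \<open>\<rho>\<close> sums to zero over each fiber \<open>F\<^bsub>h,\<alpha>\<^esub>\<close>
  (\<open>standard_arr_zero_iff_fiber_sums\<close>).

  Finally, each degree-lowering morphism of \<open>C\<^sup>-\<close> is of the form \<open>r h\<close> with \<open>h\<close> one of the chosen
  unfactorizable representatives, because a chain of proper factorizations lowers the degree at each step
  (\<open>minus_factors_through_representative\<close>). So it is enough that the representatives kill
  \<open>\<rho>\<close>, and this is the condition that \<open>\<rho>\<close> lies in the kernel of the transposed fiber matrix.\<close>

section \<open>Linear maps on modules of functions\<close>

lemma carrier_fun_module: "carrier (fun_module k S) = S \<rightarrow>\<^sub>E carrier k"
  by (simp add: fun_module_def)

lemma fun_module_add_apply: "s \<in> S \<Longrightarrow> (u \<oplus>\<^bsub>fun_module k S\<^esub> v) s = u s \<oplus>\<^bsub>k\<^esub> v s"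
  by (simp add: fun_module_def)

lemma fun_module_smult_apply: "s \<in> S \<Longrightarrow> (r \<odot>\<^bsub>fun_module k S\<^esub> u) s = r \<otimes>\<^bsub>k\<^esub> u s"
  by (simp add: fun_module_def)

lemma fun_module_zero_apply: "s \<in> S \<Longrightarrow> \<zero>\<^bsub>fun_module k S\<^esub> s = \<zero>\<^bsub>k\<^esub>"
  by (simp add: fun_module_def)

lemma basis_elem_carrier: "cring k \<Longrightarrow> basis_elem k S s \<in> S \<rightarrow>\<^sub>E carrier k"
proof -
  assume "cring k"
  then interpret k: cring k .
  show ?thesis by (auto simp: basis_elem_def)
qed

lemma module_hom_finsum:
  assumes "module k M" "module k N" and h: "h \<in> module_hom k M N"
    and "finite A" "w \<in> A \<rightarrow> carrier M"
  shows "h (\<Oplus>\<^bsub>M\<^esub>i\<in>A. w i) = (\<Oplus>\<^bsub>N\<^esub>i\<in>A. h (w i))"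
proof -
  interpret M: module k M by fact
  interpret N: module k N by fact
  note h' = module_hom_zero_neg[OF assms(1,2) h]
  show ?thesis
    using assms(4,5)
  proof (induction A rule: finite_induct)
    case (insert a A)
    then have "w \<in> A \<rightarrow> carrier M" "w a \<in> carrier M" by auto
    moreover from this have "(\<lambda>i. h (w i)) \<in> A \<rightarrow> carrier N" "h (w a) \<in> carrier N"
      using h'(1) by auto
    ultimately show ?case
      using insert by (simp add: h'(3))
  qed (simp add: h'(2))
qed

lemma fun_module_finsum_apply:
  assumes "cring k" "finite A" "w \<in> A \<rightarrow> (S \<rightarrow>\<^sub>E carrier k)" and s: "s \<in> S"
  shows "(\<Oplus>\<^bsub>fun_module k S\<^esub>i\<in>A. w i) s = (\<Oplus>\<^bsub>k\<^esub>i\<in>A. w i s)"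
proof -
  interpret k: cring k by fact
  interpret F: module k "fun_module k S" by (rule fun_module_module) fact
  show ?thesis
    using assms(2,3)
  proof (induction A rule: finite_induct)
    case (insert a A)
    then have "w \<in> A \<rightarrow> carrier (fun_module k S)" "w a \<in> carrier (fun_module k S)"
      by (auto simp: carrier_fun_module)
    moreover have "(\<lambda>i. w i s) \<in> A \<rightarrow> carrier k" "w a s \<in> carrier k"
      using insert.prems s by auto
    ultimately show ?case
      using insert s by (simp add: fun_module_add_apply)
  qed (simp add: s fun_module_zero_apply)
qed

lemma fun_module_basis_expansion:
  assumes "cring k" "finite S" and u: "u \<in> S \<rightarrow>\<^sub>E carrier k"
  shows "u = (\<Oplus>\<^bsub>fun_module k S\<^esub>s\<in>S. u s \<odot>\<^bsub>fun_module k S\<^esub> basis_elem k S s)"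
proof -
  interpret k: cring k by fact
  interpret F: module k "fun_module k S" by (rule fun_module_module) fact
  have us: "u s \<in> carrier k" if "s \<in> S" for s using u that by auto
  have w: "(\<lambda>s. u s \<odot>\<^bsub>fun_module k S\<^esub> basis_elem k S s) \<in> S \<rightarrow> carrier (fun_module k S)"
  proof (intro Pi_I F.smult_closed)
    show "u s \<in> carrier k" if "s \<in> S" for s using us that .
    show "basis_elem k S s \<in> carrier (fun_module k S)" for s
      unfolding carrier_fun_module using assms(1) by (rule basis_elem_carrier)
  qed
  have "(\<Oplus>\<^bsub>fun_module k S\<^esub>s\<in>S. u s \<odot>\<^bsub>fun_module k S\<^esub> basis_elem k S s) t = u t" if t: "t \<in> S" for t
  proof -
    have "(\<Oplus>\<^bsub>fun_module k S\<^esub>s\<in>S. u s \<odot>\<^bsub>fun_module k S\<^esub> basis_elem k S s) t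
        = (\<Oplus>\<^bsub>k\<^esub>s\<in>S. (u s \<odot>\<^bsub>fun_module k S\<^esub> basis_elem k S s) t)"
      using w by (intro fun_module_finsum_apply assms t) (simp add: carrier_fun_module)
    also have "\<dots> = (\<Oplus>\<^bsub>k\<^esub>s\<in>S. if t = s then u s else \<zero>\<^bsub>k\<^esub>)"
      using t us by (intro k.finsum_cong') (auto simp: fun_module_smult_apply basis_elem_def)
    also have "\<dots> = u t"
      by (rule k.add.finprod_singleton[OF t assms(2)]) (use us in auto)
    finally show ?thesis .
  qed
  moreover have "(\<Oplus>\<^bsub>fun_module k S\<^esub>s\<in>S. u s \<odot>\<^bsub>fun_module k S\<^esub> basis_elem k S s) \<in> S \<rightarrow>\<^sub>E carrier k"
    using F.finsum_closed[OF w] by (simp add: carrier_fun_module)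
  ultimately show ?thesis
    by (intro PiE_ext[OF u]) auto
qed

lemma module_hom_basis_expansion:
  assumes "cring k" "finite S" and M: "module k M" and h: "h \<in> module_hom k (fun_module k S) M"
    and u: "u \<in> S \<rightarrow>\<^sub>E carrier k"
  shows "h u = (\<Oplus>\<^bsub>M\<^esub>s\<in>S. u s \<odot>\<^bsub>M\<^esub> h (basis_elem k S s))"
proof -
  interpret M: module k M by fact
  have F: "module k (fun_module k S)" by (rule fun_module_module) fact
  interpret F: module k "fun_module k S" by fact
  have b: "basis_elem k S s \<in> carrier (fun_module k S)" for s
    using basis_elem_carrier[OF assms(1)] by (simp only: carrier_fun_module)
  have us: "u s \<in> carrier k" if "s \<in> S" for s using u that by auto
  note h' = module_hom_zero_neg[OF F M h]
  have "h u = h (\<Oplus>\<^bsub>fun_module k S\<^esub>s\<in>S. u s \<odot>\<^bsub>fun_module k S\<^esub> basis_elem k S s)"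
    using fun_module_basis_expansion[OF assms(1,2) u] by simp
  also have "\<dots> = (\<Oplus>\<^bsub>M\<^esub>s\<in>S. h (u s \<odot>\<^bsub>fun_module k S\<^esub> basis_elem k S s))"
    using us b by (intro module_hom_finsum[OF F M h] assms(2)) auto
  also have "\<dots> = (\<Oplus>\<^bsub>M\<^esub>s\<in>S. u s \<odot>\<^bsub>M\<^esub> h (basis_elem k S s))"
    using us b h' by (intro M.finsum_cong') auto
  finally show ?thesis .
qed

text \<open>Together with the existence of linear extensions below, this is the universal property of the
  free module on a finite set: linear maps out of it may be defined and compared on the basis.\<close>

lemma module_hom_eq_on_basis:
  assumes "cring k" "finite S" and M: "module k M"
    and g: "g \<in> module_hom k (fun_module k S) M" and h: "h \<in> module_hom k (fun_module k S) M"
    and eq: "\<And>s. s \<in> S \<Longrightarrow> g (basis_elem k S s) = h (basis_elem k S s)"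
    and u: "u \<in> S \<rightarrow>\<^sub>E carrier k"
  shows "g u = h u"
proof -
  interpret M: module k M by fact
  have F: "module k (fun_module k S)" by (rule fun_module_module) fact
  have us: "u s \<in> carrier k" if "s \<in> S" for s using u that by auto
  have "h (basis_elem k S s) \<in> carrier M" for s
    using module_hom_zero_neg(1)[OF F M h] basis_elem_carrier[OF assms(1)]
    by (metis Pi_mem carrier_fun_module)
  then show ?thesis
    unfolding module_hom_basis_expansion[OF assms(1-3) g u] module_hom_basis_expansion[OF assms(1-3) h u]
    using eq us by (auto intro!: M.finsum_cong')
qed

lemma module_hom_comp:
  "g \<in> module_hom k M N \<Longrightarrow> h \<in> module_hom k N W \<Longrightarrow> (\<lambda>v. h (g v)) \<in> module_hom k M W"
  by (auto simp: module_hom_def hom_def Pi_def)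

lemma linear_extension_exists:
  assumes "cring k" "finite S" "module k M" and w: "w \<in> S \<rightarrow> carrier M"
  obtains h where "h \<in> module_hom k (fun_module k S) M" "\<And>s. s \<in> S \<Longrightarrow> h (basis_elem k S s) = w s"
proof -
  interpret k: cring k by fact
  interpret M: module k M by fact
  have ws: "w s \<in> carrier M" if "s \<in> S" for s using w that by auto
  have us: "u s \<in> carrier k" if "u \<in> S \<rightarrow>\<^sub>E carrier k" "s \<in> S" for u s
    using that by auto
  define h where "h u = (\<Oplus>\<^bsub>M\<^esub>s\<in>S. u s \<odot>\<^bsub>M\<^esub> w s)" for u
  have "h (u \<oplus>\<^bsub>fun_module k S\<^esub> v) = h u \<oplus>\<^bsub>M\<^esub> h v"
    if "u \<in> S \<rightarrow>\<^sub>E carrier k" "v \<in> S \<rightarrow>\<^sub>E carrier k" for u v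
  proof -
    have "h (u \<oplus>\<^bsub>fun_module k S\<^esub> v) = (\<Oplus>\<^bsub>M\<^esub>s\<in>S. u s \<odot>\<^bsub>M\<^esub> w s \<oplus>\<^bsub>M\<^esub> v s \<odot>\<^bsub>M\<^esub> w s)"
      unfolding h_def using that ws us
      by (intro M.finsum_cong') (simp_all add: fun_module_add_apply M.smult_l_distr)
    also have "\<dots> = h u \<oplus>\<^bsub>M\<^esub> h v"
      unfolding h_def using that ws us by (intro M.finsum_addf) auto
    finally show ?thesis .
  qed
  moreover have "h (r \<odot>\<^bsub>fun_module k S\<^esub> u) = r \<odot>\<^bsub>M\<^esub> h u"
    if "r \<in> carrier k" "u \<in> S \<rightarrow>\<^sub>E carrier k" for r u
  proof -
    have "h (r \<odot>\<^bsub>fun_module k S\<^esub> u) = (\<Oplus>\<^bsub>M\<^esub>s\<in>S. r \<odot>\<^bsub>M\<^esub> (u s \<odot>\<^bsub>M\<^esub> w s))"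
      unfolding h_def using that ws us
      by (intro M.finsum_cong') (simp_all add: fun_module_smult_apply M.smult_assoc1)
    also have "\<dots> = r \<odot>\<^bsub>M\<^esub> h u"
      unfolding h_def using that ws us assms(2) by (intro M.finsum_smult_ldistr[symmetric]) auto
    finally show ?thesis .
  qed
  moreover have "h u \<in> carrier M" if "u \<in> S \<rightarrow>\<^sub>E carrier k" for u
    unfolding h_def using that ws us by (intro M.finsum_closed) auto
  ultimately have 1: "h \<in> module_hom k (fun_module k S) M"
    by (auto simp: module_hom_def hom_def carrier_fun_module)
  have 2: "h (basis_elem k S s) = w s" if s: "s \<in> S" for s
  proof -
    have "h (basis_elem k S s) = (\<Oplus>\<^bsub>M\<^esub>t\<in>S. if s = t then w t else \<zero>\<^bsub>M\<^esub>)"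
      unfolding h_def using ws
      by (intro M.finsum_cong') (auto simp: basis_elem_def)
    also have "\<dots> = w s"
      using s ws assms(2) by (intro M.add.finprod_singleton) auto
    finally show ?thesis .
  qed
  from that[OF 1 2] show ?thesis .
qed

lemma module_hom_factors_through_quotient:
  assumes M: "module k M" and N: "submodule N k M" and W: "module k W"
    and h: "h \<in> module_hom k M W" and zero: "\<And>v. v \<in> N \<Longrightarrow> h v = \<zero>\<^bsub>W\<^esub>"
  obtains q where "q \<in> module_hom k (quotient_module M N) W"
    "\<And>v. v \<in> carrier M \<Longrightarrow> q (N +>\<^bsub>M\<^esub> v) = h v"
proof -
  interpret M: module k M by fact
  interpret W: module k W by fact
  interpret N: abelian_subgroup N M
    using N by (intro abelian_subgroupI3 additive_subgroup.intro M.abelian_group_axioms)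
      (auto simp: submodule_def)
  note h' = module_hom_zero_neg[OF M W h]
  define q where "q X = h (SOME v. v \<in> X)" for X
  have q: "q (N +>\<^bsub>M\<^esub> v) = h v" if v: "v \<in> carrier M" for v
  proof -
    have "v \<in> N +>\<^bsub>M\<^esub> v" using v N.a_rcos_self by blast
    then have "(SOME v'. v' \<in> N +>\<^bsub>M\<^esub> v) \<in> N +>\<^bsub>M\<^esub> v" by (rule someI)
    then obtain n where n: "n \<in> N" "(SOME v'. v' \<in> N +>\<^bsub>M\<^esub> v) = n \<oplus>\<^bsub>M\<^esub> v"
      by (auto simp: a_r_coset_def')
    have "n \<in> carrier M" using n N.a_subset by auto
    moreover have "h v \<in> carrier W" using h'(1) v by auto
    ultimately show ?thesis
      using v n zero by (simp add: q_def h'(3))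
  qed
  have car: "carrier (quotient_module M N) = (\<lambda>v. N +>\<^bsub>M\<^esub> v) ` carrier M"
    by (auto simp: quotient_module_def A_RCOSETS_def')
  have "h v \<in> carrier W" if "v \<in> carrier M" for v using h'(1) that by auto
  then have "q \<in> module_hom k (quotient_module M N) W"
    by (auto simp: module_hom_def hom_def car q quotient_add[OF M N] quotient_smult[OF M N] h')
  from that[OF this q] show ?thesis .
qed

text \<open>The final isomorphism arises in this way: \<open>e\<close> evaluates morphisms of functors at the
  generator, \<open>c\<close> identifies the functions on \<open>C\<^sup>+(x,y)\<close> with \<open>\<Delta>\<^sub>x(y)\<close>, and \<open>K\<close> is the kernel of
  the transposed fiber matrix.\<close>

lemma module_iso_via_common_image:
  assumes F: "module k F" and Q: "module k Q"
    and c: "c \<in> module_iso k F Q"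
    and e: "e \<in> module_hom k M Q" "inj_on e (carrier M)"
    and K: "K \<subseteq> carrier F" "e ` carrier M = c ` K"
  shows "(\<lambda>v. inv_into (carrier F) c (e v)) \<in> module_iso k M (F\<lparr>carrier := K\<rparr>)"
proof -
  interpret F: module k F by fact
  interpret Q: module k Q by fact
  have ch: "c \<in> module_hom k F Q" and cb: "bij_betw c (carrier F) (carrier Q)"
    using c by (auto simp: module_iso_def)
  note c' = module_hom_zero_neg[OF F Q ch]
  define d where "d = inv_into (carrier F) c"
  have cd: "c (d q) = q" and dF: "d q \<in> carrier F" if "q \<in> carrier Q" for q
    using that cb unfolding d_def
    by (auto simp: bij_betw_def f_inv_into_f intro!: inv_into_into)
  have dc: "d (c u) = u" if "u \<in> carrier F" for u
    using that cb unfolding d_def by (auto simp: bij_betw_def)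
  have eQ: "e v \<in> carrier Q" if "v \<in> carrier M" for v
    using e(1) that by (auto simp: module_hom_def hom_def)
  have img: "(\<lambda>v. d (e v)) ` carrier M = K"
  proof -
    have "(\<lambda>v. d (e v)) ` carrier M = d ` c ` K" by (simp add: K(2)[symmetric] image_image)
    also have "\<dots> = K" using dc K(1) by (force simp: image_image)
    finally show ?thesis .
  qed
  have "d (q \<oplus>\<^bsub>Q\<^esub> q') = d q \<oplus>\<^bsub>F\<^esub> d q'" if "q \<in> carrier Q" "q' \<in> carrier Q" for q q'
    using that dc[of "d q \<oplus>\<^bsub>F\<^esub> d q'"] cd dF by (simp add: c'(3))
  moreover have "d (r \<odot>\<^bsub>Q\<^esub> q) = r \<odot>\<^bsub>F\<^esub> d q" if "r \<in> carrier k" "q \<in> carrier Q" for r q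
    using that dc[of "r \<odot>\<^bsub>F\<^esub> d q"] cd dF by (simp add: c'(4))
  ultimately have "(\<lambda>v. d (e v)) \<in> module_hom k M (F\<lparr>carrier := K\<rparr>)"
    using e(1) img eQ by (auto simp: module_hom_def hom_def)
  moreover have "inj_on (\<lambda>v. d (e v)) (carrier M)"
    using e(2) eQ cd by (metis (mono_tags, lifting) inj_on_def)
  ultimately show ?thesis
    using img by (simp add: module_iso_def bij_betw_def d_def)
qed

section \<open>Factorizations in a generalized Reedy category\<close>

context category
begin

lemma homset_Obj: "f \<in> homset C x y \<Longrightarrow> x \<in> Obj C \<and> y \<in> Obj C"
  using src_Obj tgt_Obj by (auto simp: homset_def)

lemma Aut_inverse:
  assumes "a \<in> Aut C x"
  obtains b where "b \<in> Aut C x" "b \<cdot> a = idt C x" "a \<cdot> b = idt C x"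
  using assms by (force simp: Aut_def iso_arrow_def inverse_arrows_def homset_def)

end

context generalized_reedy
begin

lemma minus_homset: "p \<in> minus_hom C x y \<Longrightarrow> p \<in> homset C x y"
  by (simp add: minus_hom_def)

lemma plus_homset: "q \<in> plus_hom C x y \<Longrightarrow> q \<in> homset C x y"
  by (simp add: plus_hom_def)

lemma cmp_minus: "p \<in> minus_hom C x y \<Longrightarrow> q \<in> minus_hom C y z \<Longrightarrow> q \<cdot> p \<in> minus_hom C x z"
  using wide_Minus cmp_homset[of p x y q z]
  by (auto simp: minus_hom_def wide_subcategory_def homset_def)

lemma cmp_plus: "p \<in> plus_hom C x y \<Longrightarrow> q \<in> plus_hom C y z \<Longrightarrow> q \<cdot> p \<in> plus_hom C x z"
  using wide_Plus cmp_homset[of p x y q z]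
  by (auto simp: plus_hom_def wide_subcategory_def homset_def)

lemma idt_minus: "x \<in> Obj C \<Longrightarrow> idt C x \<in> minus_hom C x x"
  using wide_Minus idt_homset by (auto simp: minus_hom_def wide_subcategory_def)

lemma minus_loop_plus: "p \<in> minus_hom C x x \<Longrightarrow> p \<in> plus_hom C x x"
  using plus_Aut minus_Aut homset_Obj minus_homset by blast

lemma minus_deg_less: "p \<in> minus_hom C x y \<Longrightarrow> x \<noteq> y \<Longrightarrow> deg C y < deg C x"
  using minus_deg[of x y] homset_Obj minus_homset by blast

lemma minus_not_iso:
  assumes "p \<in> minus_hom C x y"
  shows "iso_arrow C p \<longleftrightarrow> x = y"
proof
  show "x = y" if "iso_arrow C p"
    using that assms skeletal homset_Obj minus_homset unfolding skeletal_def by blast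
  show "iso_arrow C p" if "x = y"
    using that assms minus_Aut[of x] homset_Obj[OF minus_homset[OF assms]] by (auto simp: Aut_def)
qed

lemma lowering_minus_not_plus:
  assumes "g \<in> minus_hom C x z" "deg C z < deg C x"
  shows "g \<notin> plus_hom C x z"
  using assms plus_deg[of x z] homset_Obj[OF minus_homset[OF assms(1)]] by fastforce

text \<open>Factor \<open>s = q p\<close> and \<open>f q = q' p'\<close>. Then \<open>q' (p' p)\<close> and \<open>(f s) \<cdot> id\<close> are two
  factorizations of \<open>f s\<close>, so \<open>p' p\<close> is an endomorphism; as neither \<open>p\<close> nor \<open>p'\<close> can raise
  the degree, \<open>p\<close> is an automorphism.\<close>

lemma plus_cancel_left:
  assumes s: "s \<in> homset C x y" and f: "f \<in> homset C y z" and fs: "f \<cdot> s \<in> plus_hom C x z"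
  shows "s \<in> plus_hom C x y"
proof -
  have x: "x \<in> Obj C" using homset_Obj s by blast
  obtain w p q where pq: "p \<in> minus_hom C x w" "q \<in> plus_hom C w y" "s = q \<cdot> p"
    using factorization[OF s] by blast
  have "f \<cdot> q \<in> homset C w z" using cmp_homset pq plus_homset f by blast
  then obtain w' p' q' where pq': "p' \<in> minus_hom C w w'" "q' \<in> plus_hom C w' z" "f \<cdot> q = q' \<cdot> p'"
    using factorization by blast
  have "f \<cdot> s = (f \<cdot> q) \<cdot> p"
    using cmp_assoc[of p x w q y f z] pq f minus_homset plus_homset by simp
  also have "\<dots> = q' \<cdot> (p' \<cdot> p)"
    using cmp_assoc[of p x w p' w' q' z] pq pq' minus_homset plus_homset by simp
  finally have eq: "(f \<cdot> s) \<cdot> idt C x = q' \<cdot> (p' \<cdot> p)"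
    using cmp_idt_right[OF plus_homset[OF fs]] by simp
  have "x = w'"
    using factorization_unique[OF idt_minus[OF x] fs cmp_minus[OF pq(1) pq'(1)] pq'(2) eq] by blast
  then have "x = w"
    using minus_deg_less[OF pq(1)] minus_deg_less[OF pq'(1)] by fastforce
  then show ?thesis
    using pq minus_loop_plus cmp_plus by blast
qed

text \<open>Induction on the drop of degree: in a proper factorization \<open>p = g g'\<close> both factors lower the
  degree, so \<open>g'\<close> drops by less than \<open>p\<close> and has an unfactorizable first factor, which serves for
  \<open>p\<close> as well.\<close>

lemma minus_factors_through_unfactorizable:
  assumes "p \<in> minus_hom C y z" "y \<noteq> z"
  shows "\<exists>w h r. h \<in> unfactorizable C y w \<and> r \<in> minus_hom C w z \<and> p = r \<cdot> h"
  using assms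
proof (induction "deg C y - deg C z" arbitrary: z p rule: less_induct)
  case less
  note p = less.prems(1)
  show ?case
  proof (cases "p \<in> unfactorizable C y z")
    case True
    moreover have "idt C z \<in> minus_hom C z z"
      using homset_Obj[OF minus_homset[OF p]] idt_minus by blast
    moreover have "p = idt C z \<cdot> p"
      by (simp add: cmp_idt_left[OF minus_homset[OF p]])
    ultimately show ?thesis by blast
  next
    case False
    then obtain g g' where g: "g \<in> Minus C" "g' \<in> Minus C" "src C g = tgt C g'" "p = g \<cdot> g'"
       "\<not> iso_arrow C g" "\<not> iso_arrow C g'"
      using less.prems by (auto simp: unfactorizable_def minus_not_iso)
    define w where "w = tgt C g'"
    have A: "g \<in> Arr C" "g' \<in> Arr C" using g wide_Minus by (auto simp: wide_subcategory_def)
    have "g' \<in> minus_hom C y w" "g \<in> minus_hom C w z"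
      using g A p cmp_comp[OF A(2,1) g(3)] by (auto simp: minus_hom_def homset_def w_def)
    note gh = this
    have "y \<noteq> w" "w \<noteq> z" using g(5,6) minus_not_iso gh by blast+
    then have "deg C w < deg C y" "deg C z < deg C w" using minus_deg_less gh by blast+
    then have "deg C y - deg C w < deg C y - deg C z" by simp
    from less.hyps[OF this gh(1) \<open>y \<noteq> w\<close>] obtain v h r where
      h: "h \<in> unfactorizable C y v" "r \<in> minus_hom C v w" "g' = r \<cdot> h" by blast
    then have "p = (g \<cdot> r) \<cdot> h"
      using g(4) gh cmp_assoc[of h y v r w g z] minus_homset by (auto simp: unfactorizable_def)
    then show ?thesis using h cmp_minus gh by blast
  qed
qed

text \<open>If \<open>p = r h\<close> with \<open>h\<close> unfactorizable and \<open>a h\<close> is the representative of its orbit, then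
  \<open>p = (r a\<^sup>-\<^sup>1) (a h)\<close>.\<close>

lemma minus_factors_through_representative:
  assumes U: "orbit_representatives C U" and p: "p \<in> minus_hom C y z" "y \<noteq> z"
  obtains w h r where "w \<in> Obj C" "h \<in> U y w" "h \<in> minus_hom C y w" "r \<in> minus_hom C w z" "p = r \<cdot> h"
proof -
  obtain w h r where h: "h \<in> unfactorizable C y w" "r \<in> minus_hom C w z" "p = r \<cdot> h"
    using minus_factors_through_unfactorizable[OF p] by blast
  have hm: "h \<in> homset C y w" using h by (auto simp: unfactorizable_def minus_hom_def)
  then have yw: "y \<in> Obj C" "w \<in> Obj C" using homset_Obj by blast+
  then obtain a where a: "a \<in> Aut C w" "a \<cdot> h \<in> U y w"
    using U h unfolding orbit_representatives_def by metis
  obtain b where b: "b \<in> Aut C w" "b \<cdot> a = idt C w" using Aut_inverse[OF a(1)] by blast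
  have ab: "a \<in> minus_hom C w w" "b \<in> minus_hom C w w" using a b minus_Aut yw by auto
  have "(r \<cdot> b) \<cdot> (a \<cdot> h) = r \<cdot> ((b \<cdot> a) \<cdot> h)"
    using cmp_assoc[of "a \<cdot> h" y w b w r z] cmp_assoc[of h y w a w b w]
      cmp_homset[of h y w a w] hm ab h minus_homset by simp
  then have "p = (r \<cdot> b) \<cdot> (a \<cdot> h)" using b cmp_idt_left hm h by simp
  moreover have "a \<cdot> h \<in> minus_hom C y w" "r \<cdot> b \<in> minus_hom C w z"
    using ab h cmp_minus by (auto simp: unfactorizable_def)
  ultimately show ?thesis using that yw a by blast
qed

lemma representative_minus:
  assumes "orbit_representatives C U" "y \<in> Obj C" "w \<in> Obj C" "h \<in> U y w"
  shows "h \<in> minus_hom C y w" "deg C w < deg C y"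
proof -
  have h: "h \<in> unfactorizable C y w"
    using assms unfolding orbit_representatives_def by blast
  then show "h \<in> minus_hom C y w" by (simp add: unfactorizable_def)
  then show "deg C w < deg C y"
    using h minus_not_iso minus_deg_less by (auto simp: unfactorizable_def)
qed

end

section \<open>Standard modules\<close>

locale reedy_over_ring = generalized_reedy C + k: cring k
  for C :: "('o, 'm, 'z) reedy_scheme" (structure) and k :: "('k, 'r) ring_scheme"
begin

lemma representable_obj:
  "x \<in> Obj C \<Longrightarrow> z \<in> Obj C \<Longrightarrow> obj_map (representable k C x) z = fun_module k (homset C x z)"
  by (simp add: representable_def free_module_finite finite_homset)

lemma representable_arr_apply:
  assumes x: "x \<in> Obj C" and f: "f \<in> homset C y z" and u: "u \<in> homset C x y \<rightarrow>\<^sub>E carrier k"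
  shows "arr_map (representable k C x) f u
    = (\<lambda>t\<in>homset C x z. \<Oplus>\<^bsub>k\<^esub>s\<in>{s \<in> homset C x y. f \<cdot> s = t}. u s)"
  using assms homset_Obj[OF f] finite_homset[of x y] f
  by (auto simp: representable_def free_map_finite k.cring_axioms homset_def)

lemma representable_arr_basis:
  assumes f: "f \<in> homset C y z" and g: "g \<in> homset C x y"
  shows "arr_map (representable k C x) f (basis_elem k (homset C x y) g)
    = basis_elem k (homset C x z) (f \<cdot> g)"
proof -
  have O: "x \<in> Obj C" "y \<in> Obj C" using homset_Obj g by blast+
  have "(\<Oplus>\<^bsub>k\<^esub>s\<in>{s \<in> homset C x y. f \<cdot> s = t}. basis_elem k (homset C x y) g s)
      = (if t = f \<cdot> g then \<one>\<^bsub>k\<^esub> else \<zero>\<^bsub>k\<^esub>)" for t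
  proof -
    have "(\<Oplus>\<^bsub>k\<^esub>s\<in>{s \<in> homset C x y. f \<cdot> s = t}. basis_elem k (homset C x y) g s)
       = (\<Oplus>\<^bsub>k\<^esub>s\<in>{s \<in> homset C x y. f \<cdot> s = t}. if g = s then \<one>\<^bsub>k\<^esub> else \<zero>\<^bsub>k\<^esub>)"
      by (intro k.finsum_cong') (auto simp: basis_elem_def)
    also have "\<dots> = (if t = f \<cdot> g then \<one>\<^bsub>k\<^esub> else \<zero>\<^bsub>k\<^esub>)"
    proof (cases "t = f \<cdot> g")
      case True
      then show ?thesis using g finite_homset[OF O]
        by (subst k.add.finprod_singleton) auto
    next
      case False
      then have "(\<Oplus>\<^bsub>k\<^esub>s\<in>{s \<in> homset C x y. f \<cdot> s = t}. if g = s then \<one>\<^bsub>k\<^esub> else \<zero>\<^bsub>k\<^esub>)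
         = (\<Oplus>\<^bsub>k\<^esub>s\<in>{s \<in> homset C x y. f \<cdot> s = t}. \<zero>\<^bsub>k\<^esub>)"
        by (intro k.finsum_cong') auto
      then show ?thesis using False by simp
    qed
    finally show ?thesis .
  qed
  then show ?thesis
    using representable_arr_apply[OF O(1) f basis_elem_carrier[OF k.cring_axioms]]
    by (simp add: basis_elem_def)
qed

lemma representable_is_cmodule: "x \<in> Obj C \<Longrightarrow> is_cmodule k C (representable k C x)"
  by (rule representable_cmodule) (unfold_locales)

text \<open>For the inclusion from right to left: a morphism outside \<open>C\<^sup>+\<close> has a non-invertible part in
  \<open>C\<^sup>-\<close>, hence lies in the submodule generated by such parts. For the other one: by cancellation, the morphisms outside \<open>C\<^sup>+\<close>
  are stable under composition on the left.\<close>

lemma standard_rel_eq: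
  assumes x: "x \<in> Obj C" and z: "z \<in> Obj C"
  shows "standard_rel k C x z
    = {u \<in> homset C x z \<rightarrow>\<^sub>E carrier k. \<forall>f\<in>plus_hom C x z. u f = \<zero>\<^bsub>k\<^esub>}"
proof
  let ?P = "representable k C x"
  let ?G = "{(z, basis_elem k (homset C x z) g) | z g. g \<in> minus_hom C x z \<and> deg C z < deg C x}"
  define N where "N z = {u \<in> homset C x z \<rightarrow>\<^sub>E carrier k. \<forall>f\<in>plus_hom C x z. u f = \<zero>\<^bsub>k\<^esub>}" for z
  have fm: "module k (fun_module k S)" for S by (rule fun_module_module) unfold_locales
  have sub: "submodule (N z) k (obj_map ?P z)" if z: "z \<in> Obj C" for z
  proof -
    interpret F: module k "fun_module k (homset C x z)" by (rule fm)
    show ?thesis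
      unfolding representable_obj[OF x z]
    proof (rule F.submoduleI)
      show c: "N z \<subseteq> carrier (fun_module k (homset C x z))" by (auto simp: N_def carrier_fun_module)
      show "\<zero>\<^bsub>fun_module k (homset C x z)\<^esub> \<in> N z"
        using F.zero_closed plus_homset by (auto simp: N_def carrier_fun_module fun_module_zero_apply)
      show add: "u \<oplus>\<^bsub>fun_module k (homset C x z)\<^esub> v \<in> N z" if "u \<in> N z" "v \<in> N z" for u v
        using F.a_closed[of u v] that plus_homset
        by (auto simp: N_def carrier_fun_module fun_module_add_apply)
      show smult: "r \<odot>\<^bsub>fun_module k (homset C x z)\<^esub> u \<in> N z" if "r \<in> carrier k" "u \<in> N z" for r u
        using F.smult_closed[of r u] that plus_homset
        by (auto simp: N_def carrier_fun_module fun_module_smult_apply)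
      show "\<ominus>\<^bsub>fun_module k (homset C x z)\<^esub> u \<in> N z" if u: "u \<in> N z" for u
        \<comment> \<open>\<open>- u = (- 1) u\<close>\<close>
        using smult[of "\<ominus>\<^bsub>k\<^esub> \<one>\<^bsub>k\<^esub>" u] u c F.smult_l_minus[of "\<one>\<^bsub>k\<^esub>" u] by auto
    qed
  qed
  have "arr_map ?P f u \<in> N (tgt C f)" if f: "f \<in> Arr C" and u: "u \<in> N (src C f)" for f u
  proof -
    have f': "f \<in> homset C (src C f) (tgt C f)" using f by (simp add: homset_def)
    have u': "u \<in> homset C x (src C f) \<rightarrow>\<^sub>E carrier k" using u by (simp add: N_def)
    have z0: "u s = \<zero>\<^bsub>k\<^esub>"
      if "s \<in> homset C x (src C f)" "f \<cdot> s \<in> plus_hom C x (tgt C f)" for s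
      using u plus_cancel_left[OF that(1) f' that(2)] by (simp add: N_def)
    have "(\<Oplus>\<^bsub>k\<^esub>s\<in>{s \<in> homset C x (src C f). f \<cdot> s = t}. u s) = \<zero>\<^bsub>k\<^esub>" if t: "t \<in> plus_hom C x (tgt C f)" for t
    proof -
      have "(\<Oplus>\<^bsub>k\<^esub>s\<in>{s \<in> homset C x (src C f). f \<cdot> s = t}. u s)
          = (\<Oplus>\<^bsub>k\<^esub>s\<in>{s \<in> homset C x (src C f). f \<cdot> s = t}. \<zero>\<^bsub>k\<^esub>)"
        using z0 t by (intro k.finsum_cong') auto
      then show ?thesis by simp
    qed
    moreover have "(\<Oplus>\<^bsub>k\<^esub>s\<in>{s \<in> homset C x (src C f). f \<cdot> s = t}. u s) \<in> carrier k" for t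
      using u' by (intro k.finsum_closed) auto
    ultimately show ?thesis
      using plus_homset unfolding N_def representable_arr_apply[OF x f' u'] by auto
  qed
  then have "is_csubmodule k C ?P N" using sub by (simp add: is_csubmodule_def)
  moreover have "basis_elem k (homset C x z) g \<in> N z" if "g \<in> minus_hom C x z" "deg C z < deg C x" for z g
    using lowering_minus_not_plus[OF that] basis_elem_carrier[OF k.cring_axioms, of "homset C x z" g] plus_homset
    by (auto simp: N_def basis_elem_def)
  then have "\<forall>(z, v)\<in>?G. v \<in> N z" by blast
  ultimately show "standard_rel k C x z \<subseteq> {u \<in> homset C x z \<rightarrow>\<^sub>E carrier k. \<forall>f\<in>plus_hom C x z. u f = \<zero>\<^bsub>k\<^esub>}"
    unfolding standard_rel_def generated_csubmodule_def N_def[symmetric] by blast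
  show "{u \<in> homset C x z \<rightarrow>\<^sub>E carrier k. \<forall>f\<in>plus_hom C x z. u f = \<zero>\<^bsub>k\<^esub>} \<subseteq> standard_rel k C x z"
  proof
    let ?F = "fun_module k (homset C x z)" and ?b = "basis_elem k (homset C x z)"
    interpret F: module k ?F by (rule fm)
    fix u assume "u \<in> {u \<in> homset C x z \<rightarrow>\<^sub>E carrier k. \<forall>f\<in>plus_hom C x z. u f = \<zero>\<^bsub>k\<^esub>}"
    then have u: "u \<in> homset C x z \<rightarrow>\<^sub>E carrier k" "\<And>f. f \<in> plus_hom C x z \<Longrightarrow> u f = \<zero>\<^bsub>k\<^esub>" by auto
    have "u \<in> L z" if L: "is_csubmodule k C ?P L" and G: "\<forall>(z, v)\<in>?G. v \<in> L z" for L
    proof -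
      have "submodule (L z) k ?F" using L z x representable_obj by (auto simp: is_csubmodule_def)
      then interpret L: submodule "L z" k ?F .
      have L0: "\<zero>\<^bsub>?F\<^esub> \<in> L z" using L.one_closed by simp
      have La: "v \<oplus>\<^bsub>?F\<^esub> w \<in> L z" if "v \<in> L z" "w \<in> L z" for v w
        using L.m_closed[of v w] that by simp
      have Lsub: "L z \<subseteq> carrier ?F" using L.subset by simp
      have b: "?b g \<in> L z" if g: "g \<in> homset C x z" and np: "g \<notin> plus_hom C x z" for g
      proof -
        obtain w p q where pq: "p \<in> minus_hom C x w" "q \<in> plus_hom C w z" "g = q \<cdot> p"
          using factorization[OF g] by blast
        have "x \<noteq> w" using pq np minus_loop_plus cmp_plus by blast
        then have "basis_elem k (homset C x w) p \<in> L w"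
          using G pq(1) minus_deg_less by blast
        then have "arr_map ?P q (basis_elem k (homset C x w) p) \<in> L z"
          using L plus_homset[OF pq(2)] by (auto simp: is_csubmodule_def homset_def)
        then show ?thesis
          using representable_arr_basis[OF plus_homset[OF pq(2)] minus_homset[OF pq(1)]] pq(3) by simp
      qed
      have ub: "u g \<odot>\<^bsub>?F\<^esub> ?b g \<in> L z" if g: "g \<in> homset C x z" for g
      proof (cases "g \<in> plus_hom C x z")
        case True
        have "?b g \<in> carrier ?F"
          unfolding carrier_fun_module by (rule basis_elem_carrier) (rule k.cring_axioms)
        then show ?thesis
          using True u(2) L0 by simp
      next
        case False
        then show ?thesis using b g u by (intro L.smult_closed) auto
      qed
      have "(\<Oplus>\<^bsub>?F\<^esub>g\<in>A. u g \<odot>\<^bsub>?F\<^esub> ?b g) \<in> L z" if "finite A" "A \<subseteq> homset C x z" for A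
        using that
      proof (induction A rule: finite_induct)
        case (insert a A)
        then have "(\<lambda>g. u g \<odot>\<^bsub>?F\<^esub> ?b g) \<in> A \<rightarrow> carrier ?F" "u a \<odot>\<^bsub>?F\<^esub> ?b a \<in> carrier ?F"
          using ub Lsub by blast+
        then show ?case using insert ub La by simp
      qed (simp add: L0)
      from this[OF finite_homset[OF x z] order_refl] show ?thesis
        by (subst fun_module_basis_expansion[OF k.cring_axioms finite_homset[OF x z] u(1)])
    qed
    then show "u \<in> standard_rel k C x z"
      unfolding standard_rel_def generated_csubmodule_def by blast
  qed
qed

lemma fun_module_is_module: "module k (fun_module k S)"
  by (rule fun_module_module) (rule k.cring_axioms)

lemma basis_elem_in: "basis_elem k S s \<in> S \<rightarrow>\<^sub>E carrier k"
  by (rule basis_elem_carrier) (rule k.cring_axioms)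

lemma standard_module_cmodule: "x \<in> Obj C \<Longrightarrow> is_cmodule k C (standard_module k C x)"
  by (rule standard_module_is_cmodule) unfold_locales

lemma standard_rel_csubmodule:
  assumes x: "x \<in> Obj C"
  shows "is_csubmodule k C (representable k C x) (standard_rel k C x)"
  unfolding standard_rel_def
proof (rule generated_csubmodule_is_csubmodule[OF representable_is_cmodule[OF x] category_axioms])
  have "z \<in> Obj C \<and> basis_elem k (homset C x z) g \<in> carrier (obj_map (representable k C x) z)"
    if "g \<in> minus_hom C x z" for z g
    using homset_Obj[OF minus_homset[OF that]] basis_elem_in
    by (simp only: representable_obj carrier_fun_module simp_thms)
  then show "\<forall>(z, v)\<in>{(z, basis_elem k (homset C x z) g) | z g. g \<in> minus_hom C x z \<and> deg C z < deg C x}.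
      z \<in> Obj C \<and> v \<in> carrier (obj_map (representable k C x) z)"
    by blast
qed

lemma standard_rel_submodule:
  assumes "x \<in> Obj C" "z \<in> Obj C"
  shows "submodule (standard_rel k C x z) k (fun_module k (homset C x z))"
  using standard_rel_csubmodule[OF assms(1)] assms
  by (auto simp: is_csubmodule_def representable_obj)

lemma standard_class_coset:
  assumes "x \<in> Obj C" "z \<in> Obj C"
  shows "standard_class k C x z u = standard_rel k C x z +>\<^bsub>fun_module k (homset C x z)\<^esub> u"
  using assms by (simp add: standard_class_def representable_obj)

lemma standard_obj:
  assumes "x \<in> Obj C" "z \<in> Obj C"
  shows "obj_map (standard_module k C x) z
    = quotient_module (fun_module k (homset C x z)) (standard_rel k C x z)"
  using assms by (simp add: standard_module_def quotient_cmodule_def representable_obj)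

lemma standard_carrier:
  assumes "x \<in> Obj C" "z \<in> Obj C"
  shows "carrier (obj_map (standard_module k C x) z)
    = standard_class k C x z ` (homset C x z \<rightarrow>\<^sub>E carrier k)"
  unfolding standard_obj[OF assms] standard_class_coset[OF assms, abs_def]
  by (auto simp: quotient_module_def A_RCOSETS_def' carrier_fun_module)

lemma standard_class_hom:
  assumes "x \<in> Obj C" "z \<in> Obj C"
  shows "standard_class k C x z
    \<in> module_hom k (fun_module k (homset C x z)) (obj_map (standard_module k C x) z)"
proof -
  note q = quotient_add[OF fun_module_is_module standard_rel_submodule[OF assms]]
    quotient_smult[OF fun_module_is_module standard_rel_submodule[OF assms]]
  have "standard_class k C x z \<in> carrier (fun_module k (homset C x z)) \<rightarrow> carrier (obj_map (standard_module k C x) z)"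
    unfolding standard_carrier[OF assms] carrier_fun_module by blast
  then show ?thesis
    using q by (auto simp: module_hom_def hom_def standard_obj[OF assms] standard_class_coset[OF assms])
qed

lemma standard_arr:
  assumes x: "x \<in> Obj C" and f: "f \<in> homset C y z" and u: "u \<in> homset C x y \<rightarrow>\<^sub>E carrier k"
  shows "arr_map (standard_module k C x) f (standard_class k C x y u)
    = standard_class k C x z (arr_map (representable k C x) f u)"
proof -
  have f': "f \<in> Arr C" "src C f = y" "tgt C f = z" and yz: "y \<in> Obj C" "z \<in> Obj C"
    using f homset_Obj[OF f] by (auto simp: homset_def)
  have "u \<in> carrier (obj_map (representable k C x) (src C f))"
    using u by (simp only: f' representable_obj[OF x yz(1)] carrier_fun_module)
  from quotient_act[OF representable_is_cmodule[OF x] category_axioms standard_rel_csubmodule[OF x] f'(1) this]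
  show ?thesis
    by (simp add: standard_module_def standard_class_def f')
qed

lemma standard_class_eq_iff:
  assumes x: "x \<in> Obj C" and z: "z \<in> Obj C"
    and u: "u \<in> homset C x z \<rightarrow>\<^sub>E carrier k" and v: "v \<in> homset C x z \<rightarrow>\<^sub>E carrier k"
  shows "standard_class k C x z u = standard_class k C x z v \<longleftrightarrow> (\<forall>f\<in>plus_hom C x z. u f = v f)"
proof -
  let ?F = "fun_module k (homset C x z)" and ?N = "standard_rel k C x z"
  interpret F: module k ?F by (rule fun_module_is_module)
  interpret N: abelian_subgroup ?N ?F
    using standard_rel_submodule[OF x z]
    by (intro abelian_subgroupI3 additive_subgroup.intro F.abelian_group_axioms)
      (auto simp: submodule_def)
  have uF: "u \<in> carrier ?F" and vF: "v \<in> carrier ?F" using u v by (simp_all only: carrier_fun_module)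
  have c: "u f \<in> carrier k" "v f \<in> carrier k" if "f \<in> homset C x z" for f using u v that by auto
  show ?thesis
  proof
    assume "standard_class k C x z u = standard_class k C x z v"
    then have "u \<in> ?N +>\<^bsub>?F\<^esub> v"
      using N.a_rcos_self[OF uF] by (simp add: standard_class_coset[OF x z])
    then obtain n where n: "n \<in> ?N" "u = n \<oplus>\<^bsub>?F\<^esub> v" by (auto simp: a_r_coset_def')
    show "\<forall>f\<in>plus_hom C x z. u f = v f"
    proof
      fix f assume f: "f \<in> plus_hom C x z"
      then have "n f = \<zero>\<^bsub>k\<^esub>" using n(1) by (simp add: standard_rel_eq[OF x z])
      then have "(n \<oplus>\<^bsub>?F\<^esub> v) f = v f"
        using c(2)[OF plus_homset[OF f]] by (simp add: fun_module_add_apply[OF plus_homset[OF f]])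
      then show "u f = v f" by (simp only: n(2))
    qed
  next
    assume eq: "\<forall>f\<in>plus_hom C x z. u f = v f"
    define n where "n = (\<lambda>s\<in>homset C x z. u s \<ominus>\<^bsub>k\<^esub> v s)"
    have "n \<in> ?N"
      using eq c plus_homset by (auto simp: standard_rel_eq[OF x z] n_def a_minus_def k.r_neg)
    moreover have "(n \<oplus>\<^bsub>?F\<^esub> v) s = u s" for s
      using c u by (cases "s \<in> homset C x z")
        (auto simp: fun_module_def n_def a_minus_def k.a_assoc k.l_neg PiE_def extensional_def)
    then have "u = n \<oplus>\<^bsub>?F\<^esub> v" by (simp add: fun_eq_iff)
    ultimately have "u \<in> ?N +>\<^bsub>?F\<^esub> v" by (auto simp: a_r_coset_def')
    then show "standard_class k C x z u = standard_class k C x z v"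
      using vF N.a_repr_independence' by (simp add: standard_class_coset[OF x z])
  qed
qed

definition plus_extension :: "'o \<Rightarrow> 'o \<Rightarrow> ('m \<Rightarrow> 'k) \<Rightarrow> 'm \<Rightarrow> 'k" where
  "plus_extension x z \<rho> = (\<lambda>g\<in>homset C x z. if g \<in> plus_hom C x z then \<rho> g else \<zero>\<^bsub>k\<^esub>)"

lemma plus_extension_carrier:
  "\<rho> \<in> plus_hom C x z \<rightarrow>\<^sub>E carrier k \<Longrightarrow> plus_extension x z \<rho> \<in> homset C x z \<rightarrow>\<^sub>E carrier k"
  by (auto simp: plus_extension_def)

lemma plus_extension_apply: "g \<in> plus_hom C x z \<Longrightarrow> plus_extension x z \<rho> g = \<rho> g"
  using plus_homset by (simp add: plus_extension_def)

text \<open>\<open>\<Delta>\<^sub>x(z)\<close> is free on \<open>C\<^sup>+(x,z)\<close>: each class has exactly one member that vanishes outside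
  \<open>C\<^sup>+\<close>.\<close>

lemma plus_extension_class_iso:
  assumes x: "x \<in> Obj C" and z: "z \<in> Obj C"
  shows "(\<lambda>\<rho>. standard_class k C x z (plus_extension x z \<rho>))
    \<in> module_iso k (fun_module k (plus_hom C x z)) (obj_map (standard_module k C x) z)"
    (is "?c \<in> module_iso k ?P ?D")
proof -
  let ?F = "fun_module k (homset C x z)"
  interpret P: module k ?P by (rule fun_module_is_module)
  have "plus_extension x z \<in> module_hom k ?P ?F"
  proof -
    have "plus_extension x z \<in> carrier ?P \<rightarrow> carrier ?F"
      using plus_extension_carrier by (auto simp only: carrier_fun_module)
    moreover have "plus_extension x z (\<rho> \<oplus>\<^bsub>?P\<^esub> \<sigma>) = plus_extension x z \<rho> \<oplus>\<^bsub>?F\<^esub> plus_extension x z \<sigma>" for \<rho> \<sigma>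
      by (auto simp: plus_extension_def fun_module_def)
    moreover have "plus_extension x z (r \<odot>\<^bsub>?P\<^esub> \<rho>) = r \<odot>\<^bsub>?F\<^esub> plus_extension x z \<rho>"
      if "r \<in> carrier k" for r \<rho>
      using that by (auto simp: plus_extension_def fun_module_def)
    ultimately show ?thesis by (auto simp: module_hom_def hom_def)
  qed
  then have hom: "?c \<in> module_hom k ?P ?D"
    by (rule module_hom_comp) (rule standard_class_hom[OF x z])
  have eq: "?c \<rho> = ?c \<sigma> \<longleftrightarrow> (\<forall>f\<in>plus_hom C x z. \<rho> f = \<sigma> f)"
    if "\<rho> \<in> carrier ?P" "\<sigma> \<in> carrier ?P" for \<rho> \<sigma>
    using that standard_class_eq_iff[OF x z plus_extension_carrier plus_extension_carrier]
    by (simp add: carrier_fun_module plus_extension_apply)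
  have "inj_on ?c (carrier ?P)"
    using eq by (intro inj_onI) (metis PiE_ext carrier_fun_module)
  moreover have "carrier ?D \<subseteq> ?c ` carrier ?P"
  proof
    fix X assume "X \<in> carrier ?D"
    then obtain u where u: "u \<in> homset C x z \<rightarrow>\<^sub>E carrier k" "X = standard_class k C x z u"
      unfolding standard_carrier[OF x z] by blast
    have r: "restrict u (plus_hom C x z) \<in> plus_hom C x z \<rightarrow>\<^sub>E carrier k"
      using u plus_homset by auto
    have "X = ?c (restrict u (plus_hom C x z))"
      unfolding u(2) standard_class_eq_iff[OF x z u(1) plus_extension_carrier[OF r]]
      by (simp add: plus_extension_apply)
    then show "X \<in> ?c ` carrier ?P" using r by (auto simp only: carrier_fun_module)
  qed
  moreover have "?c ` carrier ?P \<subseteq> carrier ?D"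
    using hom by (auto simp: module_hom_def hom_def)
  ultimately show ?thesis
    using hom by (auto simp: module_iso_def bij_betw_def)
qed

text \<open>Only the coefficients at morphisms of \<open>C\<^sup>+\<close> survive in \<open>\<Delta>\<^sub>x(z)\<close>, and by cancellation \<open>h s \<in> C\<^sup>+\<close>
  happens only for \<open>s \<in> C\<^sup>+\<close>.\<close>

lemma standard_arr_zero_iff_fiber_sums:
  assumes x: "x \<in> Obj C" and h: "h \<in> homset C y z" and \<rho>: "\<rho> \<in> plus_hom C x y \<rightarrow>\<^sub>E carrier k"
  shows "arr_map (standard_module k C x) h (standard_class k C x y (plus_extension x y \<rho>))
      = \<zero>\<^bsub>obj_map (standard_module k C x) z\<^esub>
    \<longleftrightarrow> (\<forall>\<alpha>\<in>plus_hom C x z. (\<Oplus>\<^bsub>k\<^esub>\<beta>\<in>fiber C x y h \<alpha>. \<rho> \<beta>) = \<zero>\<^bsub>k\<^esub>)"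
proof -
  let ?F = "fun_module k (homset C x z)"
  interpret F: module k ?F by (rule fun_module_is_module)
  have z: "z \<in> Obj C" using homset_Obj[OF h] by blast
  note e = plus_extension_carrier[OF \<rho>]
  define w where "w = (\<lambda>t\<in>homset C x z. \<Oplus>\<^bsub>k\<^esub>s\<in>{s \<in> homset C x y. h \<cdot> s = t}. plus_extension x y \<rho> s)"
  have w: "w \<in> homset C x z \<rightarrow>\<^sub>E carrier k"
    using e unfolding w_def by (auto intro!: k.finsum_closed)
  have w_fiber: "w \<alpha> = (\<Oplus>\<^bsub>k\<^esub>\<beta>\<in>fiber C x y h \<alpha>. \<rho> \<beta>)" if \<alpha>: "\<alpha> \<in> plus_hom C x z" for \<alpha>
  proof -
    have "{s \<in> homset C x y. h \<cdot> s = \<alpha>} = fiber C x y h \<alpha>"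
      using plus_cancel_left[OF _ h] \<alpha> plus_homset by (auto simp: fiber_def)
    then show ?thesis
      using \<rho> plus_homset[OF \<alpha>] unfolding w_def
      by (auto intro!: k.finsum_cong' simp: plus_extension_apply fiber_def)
  qed
  have "standard_class k C x z \<zero>\<^bsub>?F\<^esub> = \<zero>\<^bsub>obj_map (standard_module k C x) z\<^esub>"
    using standard_module_cmodule[OF x] z
    by (intro module_hom_zero_neg(2)[OF fun_module_is_module _ standard_class_hom[OF x z]])
      (auto simp: is_cmodule_def)
  then have "arr_map (standard_module k C x) h (standard_class k C x y (plus_extension x y \<rho>))
      = \<zero>\<^bsub>obj_map (standard_module k C x) z\<^esub>
    \<longleftrightarrow> standard_class k C x z w = standard_class k C x z \<zero>\<^bsub>?F\<^esub>"
    using standard_arr[OF x h e] representable_arr_apply[OF x h e] by (simp add: w_def)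
  also have "\<dots> \<longleftrightarrow> (\<forall>\<alpha>\<in>plus_hom C x z. w \<alpha> = \<zero>\<^bsub>?F\<^esub> \<alpha>)"
    using F.zero_closed unfolding carrier_fun_module by (intro standard_class_eq_iff x z w)
  also have "\<dots> \<longleftrightarrow> (\<forall>\<alpha>\<in>plus_hom C x z. (\<Oplus>\<^bsub>k\<^esub>\<beta>\<in>fiber C x y h \<alpha>. \<rho> \<beta>) = \<zero>\<^bsub>k\<^esub>)"
    using w_fiber plus_homset by (auto simp: fun_module_zero_apply)
  finally show ?thesis .
qed

section \<open>Homomorphisms out of a standard module\<close>

definition standard_generator :: "'o \<Rightarrow> ('m \<Rightarrow> 'k) set" where
  "standard_generator y = standard_class k C y y (basis_elem k (homset C y y) (idt C y))"

text \<open>The possible images of the generator: the elements \<open>v\<close> for which the map \<open>P\<^sub>y \<rightarrow> V\<close>,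
  \<open>g \<mapsto> V(g) v\<close>, kills the generators of the submodule that is divided out in \<open>\<Delta>\<^sub>y\<close>.\<close>

definition lowering_invariants :: "('o, 'm, 'k, 'v) cmodule \<Rightarrow> 'o \<Rightarrow> 'v set" where
  "lowering_invariants V y = {v \<in> carrier (obj_map V y).
     \<forall>z. \<forall>g\<in>minus_hom C y z. deg C z < deg C y \<longrightarrow> arr_map V g v = \<zero>\<^bsub>obj_map V z\<^esub>}"

lemma standard_generator_carrier:
  assumes "y \<in> Obj C"
  shows "standard_generator y \<in> carrier (obj_map (standard_module k C y) y)"
  unfolding standard_carrier[OF assms assms] standard_generator_def
  using basis_elem_in by (rule imageI)

lemma standard_arr_generator:
  assumes g: "g \<in> homset C y z"
  shows "arr_map (standard_module k C y) g (standard_generator y)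
    = standard_class k C y z (basis_elem k (homset C y z) g)"
proof -
  have y: "y \<in> Obj C" using homset_Obj[OF g] by blast
  show ?thesis
    unfolding standard_generator_def
    using standard_arr[OF y g basis_elem_in] representable_arr_basis[OF g idt_homset[OF y]]
    by (simp add: cmp_idt_right[OF g])
qed

lemma standard_arr_generator_lowering:
  assumes g: "g \<in> minus_hom C y z" and d: "deg C z < deg C y"
  shows "arr_map (standard_module k C y) g (standard_generator y) = \<zero>\<^bsub>obj_map (standard_module k C y) z\<^esub>"
proof -
  let ?F = "fun_module k (homset C y z)"
  interpret F: module k ?F by (rule fun_module_is_module)
  have yz: "y \<in> Obj C" "z \<in> Obj C" using homset_Obj[OF minus_homset[OF g]] by auto
  have "\<zero>\<^bsub>?F\<^esub> \<in> homset C y z \<rightarrow>\<^sub>E carrier k" using F.zero_closed by (simp only: carrier_fun_module)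
  then have "standard_class k C y z (basis_elem k (homset C y z) g) = standard_class k C y z \<zero>\<^bsub>?F\<^esub>"
    using lowering_minus_not_plus[OF g d] plus_homset
    by (subst standard_class_eq_iff[OF yz basis_elem_in])
      (auto simp: basis_elem_def fun_module_zero_apply)
  moreover have "standard_class k C y z \<zero>\<^bsub>?F\<^esub> = \<zero>\<^bsub>obj_map (standard_module k C y) z\<^esub>"
    using standard_module_cmodule[OF yz(1)] yz
    by (intro module_hom_zero_neg(2)[OF fun_module_is_module _ standard_class_hom[OF yz]])
      (auto simp: is_cmodule_def)
  ultimately show ?thesis
    using standard_arr_generator[OF minus_homset[OF g]] by simp
qed

lemma nat_transf_hom:
  "\<phi> \<in> nat_transf k C V W \<Longrightarrow> x \<in> Obj C \<Longrightarrow> \<phi> x \<in> module_hom k (obj_map V x) (obj_map W x)"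
  by (auto simp: nat_transf_def)

lemma nat_transf_natural:
  "\<phi> \<in> nat_transf k C V W \<Longrightarrow> f \<in> homset C x z \<Longrightarrow> v \<in> carrier (obj_map V x) \<Longrightarrow>
   \<phi> z (arr_map V f v) = arr_map W f (\<phi> x v)"
  by (auto simp: nat_transf_def homset_def)

lemma nat_transf_eqI:
  assumes "\<phi> \<in> nat_transf k C V W" "\<psi> \<in> nat_transf k C V W"
    and eq: "\<And>x v. x \<in> Obj C \<Longrightarrow> v \<in> carrier (obj_map V x) \<Longrightarrow> \<phi> x v = \<psi> x v"
  shows "\<phi> = \<psi>"
proof (rule PiE_ext)
  show "\<phi> \<in> (\<Pi>\<^sub>E x\<in>Obj C. module_hom k (obj_map V x) (obj_map W x) \<inter> extensional (carrier (obj_map V x)))"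
    "\<psi> \<in> (\<Pi>\<^sub>E x\<in>Obj C. module_hom k (obj_map V x) (obj_map W x) \<inter> extensional (carrier (obj_map V x)))"
    using assms by (auto simp: nat_transf_def)
  then show "\<phi> x = \<psi> x" if "x \<in> Obj C" for x
    using that eq by (intro extensionalityI[of _ "carrier (obj_map V x)"]) auto
qed

lemma evaluation_hom:
  assumes y: "y \<in> Obj C" and g: "g \<in> carrier (obj_map V y)"
  shows "(\<lambda>\<phi>. \<phi> y g) \<in> module_hom k (Hom_cmodule k C V W) (obj_map W y)"
proof -
  have "\<phi> y g \<in> carrier (obj_map W y)" if "\<phi> \<in> nat_transf k C V W" for \<phi>
    using nat_transf_hom[OF that y] g by (auto simp: module_hom_def hom_def)
  then show ?thesis
    using y g by (auto simp: module_hom_def hom_def Hom_cmodule_def)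
qed

text \<open>The generator generates: the class of a basis element \<open>g\<close> is the image of the generator
  under \<open>g\<close>, so naturality determines a transformation on the classes of the basis.\<close>

lemma evaluation_at_generator_inj:
  assumes y: "y \<in> Obj C" and V: "is_cmodule k C V"
  shows "inj_on (\<lambda>\<phi>. \<phi> y (standard_generator y)) (nat_transf k C (standard_module k C y) V)"
proof (rule inj_onI)
  let ?D = "standard_module k C y"
  fix \<phi> \<psi> assume \<phi>: "\<phi> \<in> nat_transf k C ?D V" and \<psi>: "\<psi> \<in> nat_transf k C ?D V"
    and eq: "\<phi> y (standard_generator y) = \<psi> y (standard_generator y)"
  show "\<phi> = \<psi>"
  proof (rule nat_transf_eqI[OF \<phi> \<psi>])
    fix z X assume z: "z \<in> Obj C" and "X \<in> carrier (obj_map ?D z)"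
    then obtain u where u: "u \<in> homset C y z \<rightarrow>\<^sub>E carrier k" "X = standard_class k C y z u"
      unfolding standard_carrier[OF y z] by blast
    have Vz: "module k (obj_map V z)" using V z by (simp add: is_cmodule_def)
    have basis: "\<eta> z (standard_class k C y z (basis_elem k (homset C y z) g))
        = arr_map V g (\<eta> y (standard_generator y))"
      if "\<eta> \<in> nat_transf k C ?D V" "g \<in> homset C y z" for \<eta> g
      using nat_transf_natural[OF that standard_generator_carrier[OF y]] standard_arr_generator[OF that(2)]
      by simp
    have "\<phi> z (standard_class k C y z u) = \<psi> z (standard_class k C y z u)"
      by (rule module_hom_eq_on_basis[OF k.cring_axioms finite_homset[OF y z] Vz
            module_hom_comp[OF standard_class_hom[OF y z] nat_transf_hom[OF \<phi> z]]
            module_hom_comp[OF standard_class_hom[OF y z] nat_transf_hom[OF \<psi> z]] _ u(1)])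
         (simp add: basis \<phi> \<psi> eq)
    then show "\<phi> z X = \<psi> z X" by (simp add: u(2))
  qed
qed

text \<open>A morphism outside \<open>C\<^sup>+\<close> has a degree-lowering part in \<open>C\<^sup>-\<close>, which already kills \<open>v\<close>.\<close>

lemma arr_not_plus_lowering_invariant:
  assumes V: "is_cmodule k C V" and v: "v \<in> lowering_invariants V y"
    and g: "g \<in> homset C y z" "g \<notin> plus_hom C y z"
  shows "arr_map V g v = \<zero>\<^bsub>obj_map V z\<^esub>"
proof -
  obtain w p q where pq: "p \<in> minus_hom C y w" "q \<in> plus_hom C w z" "g = q \<cdot> p"
    using factorization[OF g(1)] by blast
  have "y \<noteq> w" using pq g(2) minus_loop_plus cmp_plus by blast
  then have 0: "arr_map V p v = \<zero>\<^bsub>obj_map V w\<^esub>"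
    using v pq(1) minus_deg_less[OF pq(1)] by (simp add: lowering_invariants_def)
  have p: "p \<in> Arr C" "src C p = y" "tgt C p = w" and q: "q \<in> Arr C" "src C q = w" "tgt C q = z"
    using minus_homset[OF pq(1)] plus_homset[OF pq(2)] by (auto simp: homset_def)
  have "arr_map V g v = arr_map V q (arr_map V p v)"
    using V v p q unfolding is_cmodule_def pq(3) by (auto simp: lowering_invariants_def)
  also have "\<dots> = \<zero>\<^bsub>obj_map V z\<^esub>"
    unfolding 0
  proof (rule module_hom_zero_neg(2))
    show "module k (obj_map V w)" "module k (obj_map V z)"
      using V homset_Obj[OF plus_homset[OF pq(2)]] by (auto simp: is_cmodule_def)
    show "arr_map V q \<in> module_hom k (obj_map V w) (obj_map V z)"
      using V q by (auto simp: is_cmodule_def)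
  qed
  finally show ?thesis .
qed

text \<open>By the Yoneda lemma \<open>v\<close> defines a transformation from the representable module, namely
  the linear extension of \<open>g \<mapsto> V(g) v\<close>; it kills the relations of \<open>\<Delta>\<^sub>y\<close>, which are spanned by the
  morphisms outside \<open>C\<^sup>+\<close>.\<close>

lemma nat_transf_with_generator_value:
  assumes y: "y \<in> Obj C" and V: "is_cmodule k C V" and v: "v \<in> lowering_invariants V y"
  obtains \<phi> where "\<phi> \<in> nat_transf k C (standard_module k C y) V" "\<phi> y (standard_generator y) = v"
proof -
  let ?D = "standard_module k C y"
  let ?P = "\<lambda>z. fun_module k (homset C y z)" and ?b = "\<lambda>z. basis_elem k (homset C y z)"
  have vV: "v \<in> carrier (obj_map V y)" using v by (simp add: lowering_invariants_def)
  have Vm: "module k (obj_map V z)" if "z \<in> Obj C" for z using V that by (simp add: is_cmodule_def)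
  have Vh: "arr_map V g \<in> module_hom k (obj_map V x) (obj_map V z)" if "g \<in> homset C x z" for g x z
    using V that by (auto simp: is_cmodule_def homset_def)
  have gv: "arr_map V g v \<in> carrier (obj_map V z)" if "g \<in> homset C y z" for g z
    using Vh[OF that] vV by (auto simp: module_hom_def hom_def)
  have ex: "\<exists>q. q \<in> module_hom k (obj_map ?D z) (obj_map V z) \<and>
      (\<forall>g\<in>homset C y z. q (standard_class k C y z (?b z g)) = arr_map V g v)"
    if z: "z \<in> Obj C" for z
  proof -
    obtain h where h: "h \<in> module_hom k (?P z) (obj_map V z)"
      and hb: "\<And>g. g \<in> homset C y z \<Longrightarrow> h (?b z g) = arr_map V g v"
      using linear_extension_exists[OF k.cring_axioms finite_homset[OF y z] Vm[OF z], of "\<lambda>g. arr_map V g v"] gv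
      by blast
    interpret Vz: module k "obj_map V z" by (rule Vm[OF z])
    have h0: "h u = \<zero>\<^bsub>obj_map V z\<^esub>" if "u \<in> standard_rel k C y z" for u
    proof -
      have u: "u \<in> homset C y z \<rightarrow>\<^sub>E carrier k" "\<And>f. f \<in> plus_hom C y z \<Longrightarrow> u f = \<zero>\<^bsub>k\<^esub>"
        using that unfolding standard_rel_eq[OF y z] by auto
      have "u g \<odot>\<^bsub>obj_map V z\<^esub> h (?b z g) = \<zero>\<^bsub>obj_map V z\<^esub>" if g: "g \<in> homset C y z" for g
      proof (cases "g \<in> plus_hom C y z")
        case True
        then show ?thesis using u(2) hb[OF g] gv[OF g] by simp
      next
        case False
        have "u g \<in> carrier k" using u(1) g by auto
        then show ?thesis
          using hb[OF g] arr_not_plus_lowering_invariant[OF V v g False] by simp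
      qed
      then have "(\<Oplus>\<^bsub>obj_map V z\<^esub>g\<in>homset C y z. u g \<odot>\<^bsub>obj_map V z\<^esub> h (?b z g))
          = (\<Oplus>\<^bsub>obj_map V z\<^esub>g\<in>homset C y z. \<zero>\<^bsub>obj_map V z\<^esub>)"
        by (intro Vz.finsum_cong') auto
      then show ?thesis
        using module_hom_basis_expansion[OF k.cring_axioms finite_homset[OF y z] Vm[OF z] h u(1)] by simp
    qed
    obtain q where q: "q \<in> module_hom k (obj_map ?D z) (obj_map V z)"
      "\<And>u. u \<in> carrier (?P z) \<Longrightarrow> q (standard_class k C y z u) = h u"
      using module_hom_factors_through_quotient[OF fun_module_is_module standard_rel_submodule[OF y z] Vm[OF z] h h0,
          folded standard_obj[OF y z] standard_class_coset[OF y z]]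
      by blast
    have "q (standard_class k C y z (?b z g)) = arr_map V g v" if "g \<in> homset C y z" for g
      using q(2)[unfolded carrier_fun_module, OF basis_elem_in] hb[OF that] by simp
    with q(1) show ?thesis by (intro exI[of _ q] conjI ballI)
  qed
  define q where "q z = (SOME q. q \<in> module_hom k (obj_map ?D z) (obj_map V z) \<and>
      (\<forall>g\<in>homset C y z. q (standard_class k C y z (?b z g)) = arr_map V g v))" for z
  have q: "q z \<in> module_hom k (obj_map ?D z) (obj_map V z)"
    and qb: "\<And>g. g \<in> homset C y z \<Longrightarrow> q z (standard_class k C y z (?b z g)) = arr_map V g v"
    if "z \<in> Obj C" for z
    using someI_ex[OF ex[OF that]] unfolding q_def by (rule conjunct1, rule conjunct2[THEN bspec])
  have Dm: "module k (obj_map ?D z)" if "z \<in> Obj C" for z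
    using standard_module_cmodule[OF y] that by (simp add: is_cmodule_def)
  have Dh: "arr_map ?D f \<in> module_hom k (obj_map ?D x) (obj_map ?D z)" if "f \<in> homset C x z" for f x z
    using standard_module_cmodule[OF y] that by (auto simp: is_cmodule_def homset_def)
  have nat: "q z (arr_map ?D f X) = arr_map V f (q x X)"
    if f: "f \<in> homset C x z" and X: "X \<in> carrier (obj_map ?D x)" for f x z X
  proof -
    have xz: "x \<in> Obj C" "z \<in> Obj C" using homset_Obj[OF f] by auto
    obtain u where u: "u \<in> homset C y x \<rightarrow>\<^sub>E carrier k" "X = standard_class k C y x u"
      using X unfolding standard_carrier[OF y xz(1)] by blast
    have "q z (arr_map ?D f (standard_class k C y x u)) = arr_map V f (q x (standard_class k C y x u))"
    proof (rule module_hom_eq_on_basis[OF k.cring_axioms finite_homset[OF y xz(1)] Vm[OF xz(2)] _ _ _ u(1)])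
      show "(\<lambda>u. q z (arr_map ?D f (standard_class k C y x u))) \<in> module_hom k (?P x) (obj_map V z)"
        by (rule module_hom_comp[OF module_hom_comp[OF standard_class_hom[OF y xz(1)] Dh[OF f]] q[OF xz(2)]])
      show "(\<lambda>u. arr_map V f (q x (standard_class k C y x u))) \<in> module_hom k (?P x) (obj_map V z)"
        by (rule module_hom_comp[OF module_hom_comp[OF standard_class_hom[OF y xz(1)] q[OF xz(1)]] Vh[OF f]])
      fix g assume g: "g \<in> homset C y x"
      have "q z (arr_map ?D f (standard_class k C y x (?b x g))) = q z (standard_class k C y z (?b z (f \<cdot> g)))"
        using standard_arr[OF y f basis_elem_in] representable_arr_basis[OF f g] by simp
      also have "\<dots> = arr_map V (f \<cdot> g) v" by (rule qb[OF xz(2) cmp_homset[OF g f]])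
      also have "\<dots> = arr_map V f (arr_map V g v)"
        using V f g vV by (auto simp: is_cmodule_def homset_def)
      finally show "q z (arr_map ?D f (standard_class k C y x (?b x g)))
          = arr_map V f (q x (standard_class k C y x (?b x g)))"
        by (simp add: qb[OF xz(1) g])
    qed
    then show ?thesis by (simp only: u(2))
  qed
  define \<phi> where "\<phi> = (\<lambda>z\<in>Obj C. restrict (q z) (carrier (obj_map ?D z)))"
  have "restrict (q z) (carrier (obj_map ?D z)) \<in> module_hom k (obj_map ?D z) (obj_map V z)"
    if z: "z \<in> Obj C" for z
  proof -
    interpret Dz: module k "obj_map ?D z" by (rule Dm[OF z])
    show ?thesis using q[OF z] by (auto simp: module_hom_def hom_def)
  qed
  moreover have "\<phi> (tgt C f) (arr_map ?D f X) = arr_map V f (\<phi> (src C f) X)"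
    if f: "f \<in> Arr C" and X: "X \<in> carrier (obj_map ?D (src C f))" for f X
  proof -
    have f': "f \<in> homset C (src C f) (tgt C f)" using f by (simp add: homset_def)
    have "arr_map ?D f X \<in> carrier (obj_map ?D (tgt C f))"
      using Dh[OF f'] X by (auto simp: module_hom_def hom_def)
    then show ?thesis
      using nat[OF f' X] X src_Obj[OF f] tgt_Obj[OF f] by (simp add: \<phi>_def)
  qed
  ultimately have "\<phi> \<in> nat_transf k C ?D V"
    by (auto simp: nat_transf_def \<phi>_def)
  moreover have "\<phi> y (standard_generator y) = v"
    using qb[OF y idt_homset[OF y]] standard_generator_carrier[OF y] V vV y
    by (simp add: \<phi>_def standard_generator_def is_cmodule_def)
  ultimately show ?thesis using that by blast
qed

lemma evaluation_at_generator_image: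
  assumes y: "y \<in> Obj C" and V: "is_cmodule k C V"
  shows "(\<lambda>\<phi>. \<phi> y (standard_generator y)) ` nat_transf k C (standard_module k C y) V = lowering_invariants V y"
proof
  let ?D = "standard_module k C y"
  show "(\<lambda>\<phi>. \<phi> y (standard_generator y)) ` nat_transf k C ?D V \<subseteq> lowering_invariants V y"
  proof (rule image_subsetI)
    fix \<phi> assume \<phi>: "\<phi> \<in> nat_transf k C ?D V"
    have "arr_map V g (\<phi> y (standard_generator y)) = \<zero>\<^bsub>obj_map V z\<^esub>"
      if g: "g \<in> minus_hom C y z" "deg C z < deg C y" for g z
    proof -
      have z: "z \<in> Obj C" using homset_Obj[OF minus_homset[OF g(1)]] by blast
      have "arr_map V g (\<phi> y (standard_generator y)) = \<phi> z \<zero>\<^bsub>obj_map ?D z\<^esub>"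
        using nat_transf_natural[OF \<phi> minus_homset[OF g(1)] standard_generator_carrier[OF y]]
          standard_arr_generator_lowering[OF g] by simp
      also have "\<dots> = \<zero>\<^bsub>obj_map V z\<^esub>"
        using standard_module_cmodule[OF y] V z
        by (intro module_hom_zero_neg(2)[OF _ _ nat_transf_hom[OF \<phi> z]]) (auto simp: is_cmodule_def)
      finally show ?thesis .
    qed
    moreover have "\<phi> y (standard_generator y) \<in> carrier (obj_map V y)"
      using nat_transf_hom[OF \<phi> y] standard_generator_carrier[OF y] by (auto simp: module_hom_def hom_def)
    ultimately show "\<phi> y (standard_generator y) \<in> lowering_invariants V y"
      by (simp add: lowering_invariants_def)
  qed
  show "lowering_invariants V y \<subseteq> (\<lambda>\<phi>. \<phi> y (standard_generator y)) ` nat_transf k C ?D V"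
  proof
    fix v assume "v \<in> lowering_invariants V y"
    then obtain \<phi> where "\<phi> \<in> nat_transf k C ?D V" "\<phi> y (standard_generator y) = v"
      by (rule nat_transf_with_generator_value[OF y V])
    then show "v \<in> (\<lambda>\<phi>. \<phi> y (standard_generator y)) ` nat_transf k C ?D V"
      by (intro image_eqI) auto
  qed
qed

section \<open>Fiber sums\<close>

text \<open>A degree-lowering morphism \<open>g = r h\<close>, with \<open>h\<close> a representative, kills everything that \<open>h\<close>
  kills.\<close>

lemma lowering_invariants_via_representatives:
  assumes U: "orbit_representatives C U" and y: "y \<in> Obj C" and V: "is_cmodule k C V"
  shows "lowering_invariants V y = {v \<in> carrier (obj_map V y).
     \<forall>w\<in>Obj C. \<forall>h\<in>U y w. arr_map V h v = \<zero>\<^bsub>obj_map V w\<^esub>}"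
proof
  show "lowering_invariants V y \<subseteq> {v \<in> carrier (obj_map V y).
     \<forall>w\<in>Obj C. \<forall>h\<in>U y w. arr_map V h v = \<zero>\<^bsub>obj_map V w\<^esub>}"
    using representative_minus[OF U y] by (auto simp: lowering_invariants_def)
next
  show "{v \<in> carrier (obj_map V y). \<forall>w\<in>Obj C. \<forall>h\<in>U y w. arr_map V h v = \<zero>\<^bsub>obj_map V w\<^esub>}
    \<subseteq> lowering_invariants V y"
  proof clarify
    fix v assume v: "v \<in> carrier (obj_map V y)"
      and killed: "\<forall>w\<in>Obj C. \<forall>h\<in>U y w. arr_map V h v = \<zero>\<^bsub>obj_map V w\<^esub>"
    have "arr_map V g v = \<zero>\<^bsub>obj_map V z\<^esub>" if g: "g \<in> minus_hom C y z" "deg C z < deg C y" for g z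
    proof -
      from g(2) have "y \<noteq> z" by auto
      then obtain w h r where w: "w \<in> Obj C" "h \<in> U y w" and h: "h \<in> minus_hom C y w"
        and r: "r \<in> minus_hom C w z" and grh: "g = r \<cdot> h"
        using minus_factors_through_representative[OF U g(1)] by blast
      have h': "h \<in> Arr C" "src C h = y" "tgt C h = w" and r': "r \<in> Arr C" "src C r = w" "tgt C r = z"
        using minus_homset[OF h] minus_homset[OF r] by (auto simp: homset_def)
      have "arr_map V g v = arr_map V r (arr_map V h v)"
        using V v h' r' by (auto simp: is_cmodule_def grh)
      also have "\<dots> = arr_map V r \<zero>\<^bsub>obj_map V w\<^esub>" using killed w by simp
      also have "\<dots> = \<zero>\<^bsub>obj_map V z\<^esub>"
      proof (rule module_hom_zero_neg(2))
        show "module k (obj_map V w)" "module k (obj_map V z)"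
          using V homset_Obj[OF minus_homset[OF r]] by (auto simp: is_cmodule_def)
        show "arr_map V r \<in> module_hom k (obj_map V w) (obj_map V z)"
          using V r' by (auto simp: is_cmodule_def)
      qed
      finally show ?thesis .
    qed
    then show "v \<in> lowering_invariants V y" using v by (simp add: lowering_invariants_def)
  qed
qed

text \<open>The sum over an empty fiber is zero, so the condition may be imposed for all
  \<open>\<alpha> \<in> C\<^sup>+(x,w)\<close> instead of the nonempty fibers only.\<close>

lemma fiber_kernel_carrier:
  assumes x: "x \<in> Obj C" and y: "y \<in> Obj C" and U: "orbit_representatives C U"
  shows "a_kernel (fun_module k (plus_hom C x y)) (fun_module k (fibers C U x y)) (fiber_transpose k C U x y)
    = {\<rho> \<in> plus_hom C x y \<rightarrow>\<^sub>E carrier k. \<forall>w\<in>Obj C. \<forall>h\<in>U y w. \<forall>\<alpha>\<in>plus_hom C x w.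
        (\<Oplus>\<^bsub>k\<^esub>\<beta>\<in>fiber C x y h \<alpha>. \<rho> \<beta>) = \<zero>\<^bsub>k\<^esub>}"
proof -
  have "fiber_transpose k C U x y \<rho> = \<zero>\<^bsub>fun_module k (fibers C U x y)\<^esub> \<longleftrightarrow>
     (\<forall>w\<in>Obj C. \<forall>h\<in>U y w. \<forall>\<alpha>\<in>plus_hom C x w. (\<Oplus>\<^bsub>k\<^esub>\<beta>\<in>fiber C x y h \<alpha>. \<rho> \<beta>) = \<zero>\<^bsub>k\<^esub>)"
    if \<rho>: "\<rho> \<in> plus_hom C x y \<rightarrow>\<^sub>E carrier k" for \<rho>
  proof -
    have tgt: "tgt C h = w" if "w \<in> Obj C" "h \<in> U y w" for w h
      using representative_minus(1)[OF U y that] minus_homset by (auto simp: homset_def)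
    have "fiber_transpose k C U x y \<rho> = \<zero>\<^bsub>fun_module k (fibers C U x y)\<^esub> \<longleftrightarrow>
        (\<forall>F\<in>fibers C U x y. fiber_transpose k C U x y \<rho> F = \<zero>\<^bsub>k\<^esub>)"
      by (auto simp: fiber_transpose_def transpose_map_def fun_module_def fun_eq_iff)
    also have "\<dots> \<longleftrightarrow> (\<forall>F\<in>fibers C U x y. (\<Oplus>\<^bsub>k\<^esub>f\<in>F. \<rho> f) = \<zero>\<^bsub>k\<^esub>)"
      using fiber_transpose_apply[OF k.cring_axioms generalized_reedy_axioms x y \<rho>] by simp
    also have "\<dots> \<longleftrightarrow>
       (\<forall>w\<in>Obj C. \<forall>h\<in>U y w. \<forall>\<alpha>\<in>plus_hom C x w. (\<Oplus>\<^bsub>k\<^esub>\<beta>\<in>fiber C x y h \<alpha>. \<rho> \<beta>) = \<zero>\<^bsub>k\<^esub>)"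
    proof (intro iffI ballI)
      fix w h \<alpha> assume fib: "\<forall>F\<in>fibers C U x y. (\<Oplus>\<^bsub>k\<^esub>f\<in>F. \<rho> f) = \<zero>\<^bsub>k\<^esub>"
        and w: "w \<in> Obj C" "h \<in> U y w" "\<alpha> \<in> plus_hom C x w"
      show "(\<Oplus>\<^bsub>k\<^esub>\<beta>\<in>fiber C x y h \<alpha>. \<rho> \<beta>) = \<zero>\<^bsub>k\<^esub>"
      proof (cases "fiber C x y h \<alpha> = {}")
        case False
        moreover have "h \<in> representatives_from C U y" "\<alpha> \<in> plus_hom C x (tgt C h)"
          using w tgt by (auto simp: representatives_from_def)
        ultimately have "fiber C x y h \<alpha> \<in> fibers C U x y"
          unfolding fibers_def by blast
        then show ?thesis using fib by blast
      qed simp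
    next
      fix F assume sums: "\<forall>w\<in>Obj C. \<forall>h\<in>U y w. \<forall>\<alpha>\<in>plus_hom C x w. (\<Oplus>\<^bsub>k\<^esub>\<beta>\<in>fiber C x y h \<alpha>. \<rho> \<beta>) = \<zero>\<^bsub>k\<^esub>"
        and "F \<in> fibers C U x y"
      then obtain w h \<alpha> where "w \<in> Obj C" "h \<in> U y w" "\<alpha> \<in> plus_hom C x (tgt C h)" "F = fiber C x y h \<alpha>"
        by (auto simp: fibers_def representatives_from_def)
      then show "(\<Oplus>\<^bsub>k\<^esub>f\<in>F. \<rho> f) = \<zero>\<^bsub>k\<^esub>" using sums tgt by auto
    qed
    finally show ?thesis .
  qed
  then show ?thesis
    by (auto simp: a_kernel_def kernel_def carrier_fun_module)
qed

lemma lowering_invariants_standard: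
  assumes x: "x \<in> Obj C" and y: "y \<in> Obj C" and U: "orbit_representatives C U"
  shows "lowering_invariants (standard_module k C x) y
    = (\<lambda>\<rho>. standard_class k C x y (plus_extension x y \<rho>)) ` carrier (fiber_kernel k C U x y)"
proof -
  let ?D = "standard_module k C x" and ?c = "\<lambda>\<rho>. standard_class k C x y (plus_extension x y \<rho>)"
  have K: "carrier (fiber_kernel k C U x y) = {\<rho> \<in> plus_hom C x y \<rightarrow>\<^sub>E carrier k.
      \<forall>w\<in>Obj C. \<forall>h\<in>U y w. arr_map ?D h (?c \<rho>) = \<zero>\<^bsub>obj_map ?D w\<^esub>}"
  proof -
    have "(\<forall>\<alpha>\<in>plus_hom C x w. (\<Oplus>\<^bsub>k\<^esub>\<beta>\<in>fiber C x y h \<alpha>. \<rho> \<beta>) = \<zero>\<^bsub>k\<^esub>)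
        \<longleftrightarrow> arr_map ?D h (?c \<rho>) = \<zero>\<^bsub>obj_map ?D w\<^esub>"
      if "\<rho> \<in> plus_hom C x y \<rightarrow>\<^sub>E carrier k" "w \<in> Obj C" "h \<in> U y w" for \<rho> w h
      using standard_arr_zero_iff_fiber_sums[OF x minus_homset[OF representative_minus(1)[OF U y that(2,3)]] that(1)]
      by (rule sym)
    moreover have "carrier (fiber_kernel k C U x y)
        = a_kernel (fun_module k (plus_hom C x y)) (fun_module k (fibers C U x y)) (fiber_transpose k C U x y)"
      by (simp add: fiber_kernel_def kernel_module_def)
    ultimately show ?thesis
      unfolding fiber_kernel_carrier[OF x y U] by (simp cong: conj_cong ball_cong)
  qed
  have D: "carrier (obj_map ?D y) = ?c ` (plus_hom C x y \<rightarrow>\<^sub>E carrier k)"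
    using plus_extension_class_iso[OF x y]
    by (auto simp: module_iso_def bij_betw_def carrier_fun_module)
  have "{v \<in> f ` A. Q v} = f ` {a \<in> A. Q (f a)}" for f :: "('m \<Rightarrow> 'k) \<Rightarrow> ('m \<Rightarrow> 'k) set" and A Q
    by blast
  then show ?thesis
    unfolding K lowering_invariants_via_representatives[OF U y standard_module_cmodule[OF x]] D .
qed

end

theorem theorem1p1:
  fixes C :: "('o, 'm) reedy" and k :: "'k ring" and U :: "'o \<Rightarrow> 'o \<Rightarrow> 'm set" and x y :: 'o
  assumes "generalized_reedy C" and "cring k" and "orbit_representatives C U"
    and "x \<in> Obj C" and "y \<in> Obj C"
  shows "\<exists>\<Phi> \<in> module_iso k
            (Hom_cmodule k C (standard_module k C y) (standard_module k C x))
            (fiber_kernel k C U x y).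
          \<forall>\<phi> \<in> carrier (Hom_cmodule k C (standard_module k C y) (standard_module k C x)).
            \<phi> y (standard_class k C y y (basis_elem k (homset C y y) (idt C y)))
            = standard_class k C x y
                (\<lambda>g\<in>homset C x y. if g \<in> plus_hom C x y then \<Phi> \<phi> g else \<zero>\<^bsub>k\<^esub>)"
proof -
  interpret generalized_reedy C by fact
  interpret cring k by fact
  interpret reedy_over_ring C k by unfold_locales
  note U = assms(3) and x = assms(4) and y = assms(5)
  let ?M = "Hom_cmodule k C (standard_module k C y) (standard_module k C x)"
  let ?F = "fun_module k (plus_hom C x y)"
  let ?Q = "obj_map (standard_module k C x) y"
  define e where "e \<phi> = \<phi> y (standard_generator y)" for \<phi> :: "'o \<Rightarrow> ('m \<Rightarrow> 'k) set \<Rightarrow> ('m \<Rightarrow> 'k) set"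
  define c where "c \<rho> = standard_class k C x y (plus_extension x y \<rho>)" for \<rho>
  define K where "K = carrier (fiber_kernel k C U x y)"
  have K: "fiber_kernel k C U x y = ?F\<lparr>carrier := K\<rparr>" and KF: "K \<subseteq> carrier ?F"
    by (auto simp: K_def fiber_kernel_def kernel_module_def a_kernel_def kernel_def)
  have Q: "module k ?Q" and D: "is_cmodule k C (standard_module k C x)"
    using standard_module_cmodule[OF x] y by (auto simp: is_cmodule_def)
  have M: "carrier ?M = nat_transf k C (standard_module k C y) (standard_module k C x)"
    by (simp add: Hom_cmodule_def)
  have e: "e \<in> module_hom k ?M ?Q" "inj_on e (carrier ?M)"
    unfolding e_def[abs_def] M
    by (rule evaluation_hom[OF y standard_generator_carrier[OF y]])
      (rule evaluation_at_generator_inj[OF y D])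
  have img: "e ` carrier ?M = c ` K"
    unfolding e_def[abs_def] c_def[abs_def] K_def M
    using evaluation_at_generator_image[OF y D] lowering_invariants_standard[OF x y U] by simp
  have c: "c \<in> module_iso k ?F ?Q"
    unfolding c_def[abs_def] by (rule plus_extension_class_iso[OF x y])
  show ?thesis
  proof (rule bexI)
    show "(\<lambda>\<phi>. inv_into (carrier ?F) c (e \<phi>)) \<in> module_iso k ?M (fiber_kernel k C U x y)"
      unfolding K by (rule module_iso_via_common_image[OF fun_module_is_module Q c e KF img])
    show "\<forall>\<phi>\<in>carrier ?M. \<phi> y (standard_class k C y y (basis_elem k (homset C y y) (idt C y)))
        = standard_class k C x y
            (\<lambda>g\<in>homset C x y. if g \<in> plus_hom C x y then inv_into (carrier ?F) c (e \<phi>) g else \<zero>\<^bsub>k\<^esub>)"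
    proof
      fix \<phi> assume "\<phi> \<in> carrier ?M"
      then have "e \<phi> \<in> c ` K" unfolding img[symmetric] by (rule imageI)
      then have "e \<phi> \<in> c ` carrier ?F" using KF by (rule image_mono[THEN subsetD, rotated])
      then have "c (inv_into (carrier ?F) c (e \<phi>)) = \<phi> y (standard_generator y)"
        by (simp only: f_inv_into_f e_def)
      then show "\<phi> y (standard_class k C y y (basis_elem k (homset C y y) (idt C y)))
        = standard_class k C x y
            (\<lambda>g\<in>homset C x y. if g \<in> plus_hom C x y then inv_into (carrier ?F) c (e \<phi>) g else \<zero>\<^bsub>k\<^esub>)"
        unfolding c_def plus_extension_def standard_generator_def by (rule sym)
    qed
  qed
qed

end
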